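(* Let $M$ be a simply connected domain in $\mathbb{C}$ with coordinate $z$ and metric conformal to $dz\,d\bar z$. Let $\varphi:M\to\mathbb{H}P^n$ be a linearly full totally real isometric harmonic map generating the harmonic sequence $(\underline\varphi_k)_{k\in\mathbb{Z}}$ in $G(2,2n+2)$, $\underline\varphi_0=\underline\varphi$, consisting of rank-2 harmonic subbundles of $M\times\mathbb{C}^{2n+2}$ with $\underline\varphi_{-k}=\mathrm{j}\underline\varphi_k$. Let $[s]:M\to\mathbb{C}P^{2n+1}$ be a totally real horizontal minimal lift of $\varphi$, and suppose it generates the harmonic sequence $$\cdots\leftarrow\underline f_{-m}\leftarrow\cdots\leftarrow\underline f_{-1}\leftarrow\underline f_0=[s]\rightarrow\underline f_1\rightarrow\cdots\rightarrow\underline f_m\rightarrow\cdots$$ in $\mathbb{C}P^{2n+1}$, where all $\underline f_k,\underline f_{-k}$ are line bundles. Then for every $k=0,1,2,\dots$, $$\langle f_k,\mathrm{j}f_{-q}\rangle=\langle \mathrm{j}f_{-k},f_q\rangle=0\qquad(q=k-2,\,k-1,\,k),$$ and $$\underline\varphi_k=\underline f_k\oplus\mathrm{j}\underline f_{-k}.$$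
   Context: Identify $\mathbb{C}^{2n+2}$ with $\mathbb{H}^{n+1}$ by $(z_1,z_2,\dots,z_{2n+1},z_{2n+2})\leftrightarrow(z_1+z_2\mathrm{j},\dots,z_{2n+1}+z_{2n+2}\mathrm{j})$, with the standard Hermitian product $\langle z,w\rangle=\sum_k z_k\bar w_k$ and real inner product $\mathrm{Re}\langle\cdot,\cdot\rangle$. Left multiplication by $\mathrm{j}$ is the conjugate-linear map $\mathrm{j}v=J_{n+1}\bar v$, where $J_{n+1}$ is block diagonal with $n+1$ blocks $\begin{pmatrix}0&-1\\1&0\end{pmatrix}$. $\mathbb{H}P^n$ is the space of one-dimensional quaternionic subspaces of $\mathbb{H}^{n+1}$ for left scalar multiplication. Write $\pi:S^{4n+3}\to\mathbb{H}P^n$, $\pi(q)=[z_1+z_2\mathrm{j},\dots,z_{2n+1}+z_{2n+2}\mathrm{j}]$; its horizontal space at $q$ is $\mathcal H_q=\{v:\langle v,q\rangle=\langle v,\mathrm{j}q\rangle=0\}$, and $\mathbb{H}P^n$ has the metric making $\pi$ a Riemannian submersion from the unit sphere. The local quaternionic Kähler structure $\{I,J,K\}$ is induced on $\mathcal H_q\cong T_{\pi(q)}\mathbb{H}P^n$ by left multiplication by $\mathrm{i},\mathrm{j},\mathrm{k}$. $\mathbb{C}P^{2n+1}$ carries the Fubini–Study metric of constant holomorphic sectional curvature $4$. An isometric immersion into $\mathbb{H}P^n$ is totally real if the two-forms $\omega_I(X,Y)=g(IX,Y)$, $\omega_J(X,Y)=g(JX,Y)$, $\omega_K(X,Y)=g(KX,Y)$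 all pull back to zero at each point; an isometric immersion into $\mathbb{C}P^{2n+1}$ is totally real if the Kähler form pulls back to zero. $\varphi$ is linearly full if its image lies in no proper quaternionic projective subspace of $\mathbb{H}P^n$. A totally real horizontal minimal lift of $\varphi$ is a totally real isometric minimal immersion $[s]:M\to\mathbb{C}P^{2n+1}$ with $s:M\to S^{4n+3}$, $\pi\circ s=\varphi$ and $\langle ds,s\rangle=\langle ds,\mathrm{j}s\rangle=0$ (such a lift always exists). Harmonic sequences. $\mathbb{H}P^n$ is viewed as a totally geodesic submanifold of $G(2,2n+2)$ via $\pi(q)\mapsto\mathrm{span}_{\mathbb{C}}\{q,\mathrm{j}q\}$. For a harmonic subbundle $\underline\psi$ of $M\times\mathbb{C}^{2n+2}$ set $A'_\psi(v)=\pi_{\psi^\perp}(\partial_zv)$ and $A''_\psi(v)=\pi_{\psi^\perp}(\partial_{\bar z}v)$ for sections $v$ of $\underline\psi$, where $\pi_{\psi^\perp}$ is orthogonal projection onto $\underline\psi^\perp$. Then, for $k\ge0$, $\underline\varphi_{k+1}$ is the image bundle of $A'_{\varphi_k}$ and $\underline\varphi_{-k-1}$ the image bundle of $A''_{\varphi_{-k}}$ (extended across isolated points); $\underline f_{k+1}$, $\underline f_{-k-1}$ are obtained in the same way from $\underline f_k$, $\underline f_{-k}$. The sections $f_k$ of $\underline f_k$ are given by $f_0=s$ and, for $k\ge0$, $f_{k+1}=\partial_zf_k-\frac{\langle\partial_zf_k,f_k\rangle}{|f_k|^2}f_k$, $f_{-k-1}=\partial_{\bar z}f_{-k}-\frac{\langle\partial_{\bar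 z}f_{-k},f_{-k}\rangle}{|f_{-k}|^2}f_{-k}$. *)

theory Defs
  imports "HOL-Analysis.Analysis"
begin

subsection \<open>The space \<open>\<complex>\<^sup>2\<^sup>n\<^sup>+\<^sup>2 = \<bbbH>\<^sup>n\<^sup>+\<^sup>1\<close>\<close>

text \<open>
  The index type \<open>'m\<close> numbers the \<open>n + 1\<close> quaternionic coordinates, so \<open>CARD('m) = n + 1\<close>;
  the \<open>a\<close>-th quaternionic coordinate of \<open>v\<close> is \<open>v $ (a, 1) + v $ (a, 2) j\<close>. The library
  inner product on this type is the real part of \<open>herm\<close>, and \<open>c *s v\<close>, \<open>vec.span\<close>,
  \<open>vec.subspace\<close>, \<open>vec.dependent\<close> are taken over the complex numbers.
\<close>

type_synonym 'm cvec = "complex ^ ('m \<times> 2)"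

definition herm :: "'m::finite cvec \<Rightarrow> 'm cvec \<Rightarrow> complex" where
  "herm v w = (\<Sum>p\<in>UNIV. v $ p * cnj (w $ p))"

definition jmul :: "'m::finite cvec \<Rightarrow> 'm cvec" where
  "jmul v = (\<chi> p. if snd p = 1 then - cnj (v $ (fst p, 2)) else cnj (v $ (fst p, 1)))"

definition quaternionic_subspace :: "'m::finite cvec set \<Rightarrow> bool" where
  "quaternionic_subspace V \<longleftrightarrow> vec.subspace V \<and> jmul ` V \<subseteq> V"

definition proj :: "'m::finite cvec set \<Rightarrow> 'm cvec \<Rightarrow> 'm cvec" where
  "proj W v = (THE p. p \<in> W \<and> (\<forall>w\<in>W. herm (v - p) w = 0))"

definition perp :: "'m::finite cvec set \<Rightarrow> 'm cvec \<Rightarrow> 'm cvec" where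
  "perp W v = v - proj W v"


subsection \<open>Smooth maps and derivatives\<close>

primrec Ck_on :: "nat \<Rightarrow> 'a::real_normed_vector set \<Rightarrow> ('a \<Rightarrow> 'b::real_normed_vector) \<Rightarrow> bool" where
  "Ck_on 0 U f \<longleftrightarrow> continuous_on U f"
| "Ck_on (Suc k) U f \<longleftrightarrow>
     f differentiable_on U \<and> (\<forall>X. Ck_on k U (\<lambda>x. frechet_derivative f (at x) X))"

text \<open>Only used for open \<open>U\<close>.\<close>

definition smooth_on :: "'a::real_normed_vector set \<Rightarrow> ('a \<Rightarrow> 'b::real_normed_vector) \<Rightarrow> bool" where
  "smooth_on U f \<longleftrightarrow> (\<forall>k. Ck_on k U f)"

text \<open>Tangent vectors of the domain are complex numbers: \<open>\<partial>\<^sub>x = 1\<close> and \<open>\<partial>\<^sub>y = \<i>\<close>.\<close>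

definition dd :: "(complex \<Rightarrow> 'm::finite cvec) \<Rightarrow> complex \<Rightarrow> complex \<Rightarrow> 'm cvec" where
  "dd v X z = frechet_derivative v (at z) X"

definition dz :: "(complex \<Rightarrow> 'm::finite cvec) \<Rightarrow> complex \<Rightarrow> 'm cvec" where
  "dz v z = (1/2) *s (dd v 1 z - \<i> *s dd v \<i> z)"

definition dzbar :: "(complex \<Rightarrow> 'm::finite cvec) \<Rightarrow> complex \<Rightarrow> 'm cvec" where
  "dzbar v z = (1/2) *s (dd v 1 z + \<i> *s dd v \<i> z)"


subsection \<open>Subbundles of the trivial bundle as maps into a Grassmannian\<close>

definition subbundle :: "complex set \<Rightarrow> nat \<Rightarrow> (complex \<Rightarrow> 'm::finite cvec set) \<Rightarrow> bool" where
  "subbundle M r \<psi> \<longleftrightarrow>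
     (\<forall>z\<in>M. \<exists>U e. open U \<and> z \<in> U \<and> U \<subseteq> M \<and> (\<forall>i<r. smooth_on U (e i)) \<and>
        (\<forall>w\<in>U. inj_on (\<lambda>i::nat. e i w) {..<r} \<and>
               \<not> vec.dependent ((\<lambda>i. e i w) ` {..<r}) \<and>
               \<psi> w = vec.span ((\<lambda>i. e i w) ` {..<r})))"

definition smooth_section ::
    "complex set \<Rightarrow> (complex \<Rightarrow> 'm::finite cvec set) \<Rightarrow> (complex \<Rightarrow> 'm cvec) \<Rightarrow> bool" where
  "smooth_section U \<psi> v \<longleftrightarrow> smooth_on U v \<and> (\<forall>w\<in>U. v w \<in> \<psi> w)"

text \<open>
  The tangent space of the Grassmannian at \<open>W\<close> is \<open>Hom(W, W\<^sup>\<bottom>)\<close>, with the metric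
  \<open>Re tr(B\<^sup>* A)\<close>. The differential of \<open>\<psi>\<close> sends \<open>X\<close> to the homomorphism that maps the value at
  \<open>z\<close> of a section \<open>v\<close> of \<open>\<psi>\<close> to \<open>differential \<psi> X v z\<close>. The Levi-Civita connection is the one
  induced on \<open>Hom(\<psi>, \<psi>\<^sup>\<bottom>)\<close> by projecting flat derivatives, so \<open>hessian \<psi> X v\<close> is
  \<open>(\<nabla>\<^sub>X (d\<psi> X)) v\<close>.
\<close>

definition differential ::
    "(complex \<Rightarrow> 'm::finite cvec set) \<Rightarrow> complex \<Rightarrow> (complex \<Rightarrow> 'm cvec) \<Rightarrow> complex \<Rightarrow> 'm cvec" where
  "differential \<psi> X v z = perp (\<psi> z) (dd v X z)"

definition hessian ::
    "(complex \<Rightarrow> 'm::finite cvec set) \<Rightarrow> complex \<Rightarrow> (complex \<Rightarrow> 'm cvec) \<Rightarrow> complex \<Rightarrow> 'm cvec" where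
  "hessian \<psi> X v z =
     perp (\<psi> z) (dd (differential \<psi> X v) X z)
     - differential \<psi> X (\<lambda>w. proj (\<psi> w) (dd v X w)) z"

text \<open>
  The tension field is taken for the flat metric on the domain. For a metric \<open>g \<bar>dz\<bar>\<^sup>2\<close> in
  dimension two the Christoffel terms cancel in the trace and the tension field is divided
  by \<open>g\<close>, so its vanishing does not depend on the conformal factor.
\<close>

definition tension ::
    "(complex \<Rightarrow> 'm::finite cvec set) \<Rightarrow> (complex \<Rightarrow> 'm cvec) \<Rightarrow> complex \<Rightarrow> 'm cvec" where
  "tension \<psi> v z = hessian \<psi> 1 v z + hessian \<psi> \<i> v z"

definition harmonic_subbundle :: "complex set \<Rightarrow> nat \<Rightarrow> (complex \<Rightarrow> 'm::finite cvec set) \<Rightarrow> bool" where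
  "harmonic_subbundle M r \<psi> \<longleftrightarrow>
     subbundle M r \<psi> \<and>
     (\<forall>U v. open U \<longrightarrow> U \<subseteq> M \<longrightarrow> smooth_section U \<psi> v \<longrightarrow> (\<forall>z\<in>U. tension \<psi> v z = 0))"


subsection \<open>Harmonic sequences\<close>

definition A' :: "(complex \<Rightarrow> 'm::finite cvec set) \<Rightarrow> (complex \<Rightarrow> 'm cvec) \<Rightarrow> complex \<Rightarrow> 'm cvec" where
  "A' \<psi> v z = perp (\<psi> z) (dz v z)"

definition A'' :: "(complex \<Rightarrow> 'm::finite cvec set) \<Rightarrow> (complex \<Rightarrow> 'm cvec) \<Rightarrow> complex \<Rightarrow> 'm cvec" where
  "A'' \<psi> v z = perp (\<psi> z) (dzbar v z)"

text \<open>Image at \<open>z\<close> of an operator on local sections of \<open>\<psi>\<close>.\<close>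

definition image_at ::
    "complex set \<Rightarrow> ((complex \<Rightarrow> 'm::finite cvec set) \<Rightarrow> (complex \<Rightarrow> 'm cvec) \<Rightarrow> complex \<Rightarrow> 'm cvec)
     \<Rightarrow> (complex \<Rightarrow> 'm cvec set) \<Rightarrow> complex \<Rightarrow> 'm cvec set" where
  "image_at M A \<psi> z = {A \<psi> v z |v. \<exists>U. open U \<and> z \<in> U \<and> U \<subseteq> M \<and> smooth_section U \<psi> v}"

text \<open>
  The equality with the pointwise image is required off a set of isolated points of \<open>M\<close>
  (a set without limit points in \<open>M\<close>); there the bundle \<open>\<Psi> (k + 1)\<close> is the smooth extension.
\<close>

definition harmonic_sequence ::
    "complex set \<Rightarrow> nat \<Rightarrow> (int \<Rightarrow> complex \<Rightarrow> 'm::finite cvec set) \<Rightarrow> bool" where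
  "harmonic_sequence M r \<Psi> \<longleftrightarrow>
     (\<forall>k. harmonic_subbundle M r (\<Psi> k)) \<and>
     (\<forall>k\<ge>0. eventually (\<lambda>z. \<Psi> (k + 1) z = image_at M A' (\<Psi> k) z) (cosparse M)) \<and>
     (\<forall>k\<ge>0. eventually (\<lambda>z. \<Psi> (- k - 1) z = image_at M A'' (\<Psi> (- k)) z) (cosparse M))"

text \<open>
  At a zero of \<open>f\<^sub>k\<close> the quotient in the recursion is a removable singularity: where it is defined,
  \<open>f\<^sub>k\<^sub>+\<^sub>1 = A' f\<^sub>k\<close>, and \<open>A'\<close> is linear over functions, so the continuous extension of \<open>f\<^sub>k\<^sub>+\<^sub>1\<close>
  vanishes at the zeros of \<open>f\<^sub>k\<close>. Likewise for \<open>f\<^sub>-\<^sub>k\<^sub>-\<^sub>1\<close>.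
\<close>

primrec f_up :: "(complex \<Rightarrow> 'm::finite cvec) \<Rightarrow> nat \<Rightarrow> complex \<Rightarrow> 'm cvec" where
  "f_up s 0 = s"
| "f_up s (Suc k) = (\<lambda>z. if f_up s k z = 0 then 0
     else dz (f_up s k) z
       - (herm (dz (f_up s k) z) (f_up s k z) / of_real ((norm (f_up s k z))\<^sup>2)) *s f_up s k z)"

primrec f_down :: "(complex \<Rightarrow> 'm::finite cvec) \<Rightarrow> nat \<Rightarrow> complex \<Rightarrow> 'm cvec" where
  "f_down s 0 = s"
| "f_down s (Suc k) = (\<lambda>z. if f_down s k z = 0 then 0
     else dzbar (f_down s k) z
       - (herm (dzbar (f_down s k) z) (f_down s k z) / of_real ((norm (f_down s k z))\<^sup>2))
           *s f_down s k z)"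

definition f_seq :: "(complex \<Rightarrow> 'm::finite cvec) \<Rightarrow> int \<Rightarrow> complex \<Rightarrow> 'm cvec" where
  "f_seq s k = (if k \<ge> 0 then f_up s (nat k) else f_down s (nat (- k)))"


subsection \<open>Maps into quaternionic projective space\<close>

text \<open>A point of the quaternionic projective space is a quaternionic line, that is, some \<open>hp q\<close>
  with \<open>q \<noteq> 0\<close>.\<close>

definition hp :: "'m::finite cvec \<Rightarrow> 'm cvec set" where
  "hp q = vec.span {q, jmul q}"

definition hp_lift ::
    "complex set \<Rightarrow> (complex \<Rightarrow> 'm::finite cvec set) \<Rightarrow> (complex \<Rightarrow> 'm cvec) \<Rightarrow> bool" where
  "hp_lift U \<phi> q \<longleftrightarrow> smooth_on U q \<and> (\<forall>w\<in>U. norm (q w) = 1 \<and> hp (q w) = \<phi> w)"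

definition hp_smooth :: "complex set \<Rightarrow> (complex \<Rightarrow> 'm::finite cvec set) \<Rightarrow> bool" where
  "hp_smooth M \<phi> \<longleftrightarrow> (\<forall>z\<in>M. \<exists>U q. open U \<and> z \<in> U \<and> U \<subseteq> M \<and> hp_lift U \<phi> q)"

text \<open>
  For a local lift \<open>q\<close> of \<open>\<phi>\<close> to the unit sphere, the horizontal space at \<open>q w\<close> is the orthogonal
  complement of \<open>\<phi> w\<close>, so \<open>differential \<phi> X q w\<close> is the horizontal part of \<open>dq(X)\<close>. It
  represents \<open>d\<phi>(X)\<close>, and the metric on the projective space, for which \<open>hp\<close> is a Riemannian
  submersion, is the real inner product of these representatives. In the same way \<open>tension \<phi> q w\<close>
  represents the tension field of \<open>\<phi>\<close>: a tangent vector is a quaternion-linear map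
  \<open>\<phi> w \<rightarrow> (\<phi> w)\<^sup>\<bottom>\<close>, determined by its value at \<open>q w\<close>.
\<close>

definition hp_isometric ::
    "complex set \<Rightarrow> (complex \<Rightarrow> real) \<Rightarrow> (complex \<Rightarrow> 'm::finite cvec set) \<Rightarrow> bool" where
  "hp_isometric M g \<phi> \<longleftrightarrow>
     (\<forall>U q. open U \<longrightarrow> U \<subseteq> M \<longrightarrow> hp_lift U \<phi> q \<longrightarrow>
        (\<forall>w\<in>U. \<forall>X Y. differential \<phi> X q w \<bullet> differential \<phi> Y q w = g w * (X \<bullet> Y)))"

definition hp_totally_real :: "complex set \<Rightarrow> (complex \<Rightarrow> 'm::finite cvec set) \<Rightarrow> bool" where
  "hp_totally_real M \<phi> \<longleftrightarrow>
     (\<forall>U q. open U \<longrightarrow> U \<subseteq> M \<longrightarrow> hp_lift U \<phi> q \<longrightarrow>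
        (\<forall>w\<in>U. \<forall>X Y.
           (\<i> *s differential \<phi> X q w) \<bullet> differential \<phi> Y q w = 0 \<and>
           jmul (differential \<phi> X q w) \<bullet> differential \<phi> Y q w = 0 \<and>
           (\<i> *s jmul (differential \<phi> X q w)) \<bullet> differential \<phi> Y q w = 0))"

definition hp_harmonic :: "complex set \<Rightarrow> (complex \<Rightarrow> 'm::finite cvec set) \<Rightarrow> bool" where
  "hp_harmonic M \<phi> \<longleftrightarrow>
     (\<forall>U q. open U \<longrightarrow> U \<subseteq> M \<longrightarrow> hp_lift U \<phi> q \<longrightarrow> (\<forall>w\<in>U. tension \<phi> q w = 0))"

definition linearly_full :: "complex set \<Rightarrow> (complex \<Rightarrow> 'm::finite cvec set) \<Rightarrow> bool" where
  "linearly_full M \<phi> \<longleftrightarrow>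
     \<not> (\<exists>V. quaternionic_subspace V \<and> V \<noteq> UNIV \<and> (\<forall>z\<in>M. \<phi> z \<subseteq> V))"


subsection \<open>Maps into complex projective space and horizontal lifts\<close>

definition cp :: "'m::finite cvec \<Rightarrow> 'm cvec set" where
  "cp q = vec.span {q}"

text \<open>
  In the next three definitions \<open>s\<close> is a smooth lift to the unit sphere of the map \<open>[s]\<close>, and
  \<open>differential (\<lambda>w. cp (s w)) X s z\<close> is the part of \<open>ds(X)\<close> horizontal for the Hopf fibration;
  the Fubini-Study metric of holomorphic sectional curvature 4 is the one making that
  fibration a Riemannian submersion. The mean curvature of an isometric immersion of a
  surface is half its tension field.
\<close>

definition cp_isometric ::
    "complex set \<Rightarrow> (complex \<Rightarrow> real) \<Rightarrow> (complex \<Rightarrow> 'm::finite cvec) \<Rightarrow> bool" where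
  "cp_isometric M g s \<longleftrightarrow>
     (\<forall>z\<in>M. \<forall>X Y. differential (\<lambda>w. cp (s w)) X s z \<bullet> differential (\<lambda>w. cp (s w)) Y s z
                   = g z * (X \<bullet> Y))"

definition cp_totally_real :: "complex set \<Rightarrow> (complex \<Rightarrow> 'm::finite cvec) \<Rightarrow> bool" where
  "cp_totally_real M s \<longleftrightarrow>
     (\<forall>z\<in>M. \<forall>X Y.
        (\<i> *s differential (\<lambda>w. cp (s w)) X s z) \<bullet> differential (\<lambda>w. cp (s w)) Y s z = 0)"

definition cp_minimal_immersion ::
    "complex set \<Rightarrow> (complex \<Rightarrow> real) \<Rightarrow> (complex \<Rightarrow> 'm::finite cvec) \<Rightarrow> bool" where
  "cp_minimal_immersion M g s \<longleftrightarrow>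
     cp_isometric M g s \<and> (\<forall>z\<in>M. tension (\<lambda>w. cp (s w)) s z = 0)"

definition totally_real_horizontal_minimal_lift ::
    "complex set \<Rightarrow> (complex \<Rightarrow> real) \<Rightarrow> (complex \<Rightarrow> 'm::finite cvec set) \<Rightarrow> (complex \<Rightarrow> 'm cvec)
     \<Rightarrow> bool" where
  "totally_real_horizontal_minimal_lift M g \<phi> s \<longleftrightarrow>
     hp_lift M \<phi> s \<and>
     cp_minimal_immersion M g s \<and> cp_totally_real M s \<and>
     (\<forall>z\<in>M. \<forall>X. herm (dd s X z) (s z) = 0 \<and> herm (dd s X z) (jmul (s z)) = 0)"


definition direct_sum :: "'m::finite cvec set \<Rightarrow> 'm cvec set \<Rightarrow> 'm cvec set \<Rightarrow> bool" where
  "direct_sum W A B \<longleftrightarrow> W = {a + b |a b. a \<in> A \<and> b \<in> B} \<and> A \<inter> B = {0}"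

end

theory Submission imports Defs begin

text \<open>
  Write \<open>\<omega>(v, w) = \<langle>v, jw\<rangle>\<close>, a complex bilinear alternating form, and \<open>\<partial>'\<close>, \<open>\<partial>''\<close> for the
  derivatives by \<open>z\<close> and its conjugate. Horizontality and minimality of the lift give
  \<open>\<partial>'' f\<^sub>1 \<in> span f\<^sub>0\<close>, and isometry gives \<open>f\<^sub>1 \<bottom> f\<^sub>-\<^sub>1\<close>; commuting \<open>\<partial>'\<close> with \<open>\<partial>''\<close> propagates this to
  \<open>\<partial>'' f\<^sub>k\<^sub>+\<^sub>1 \<in> span f\<^sub>k\<close> and \<open>f\<^sub>k\<^sub>+\<^sub>2 \<bottom> f\<^sub>k\<close>. Differentiating \<open>\<omega>(f\<^sub>k, f\<^sub>-\<^sub>l) = 0\<close> then raises one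
  index at a time, which yields the orthogonality relations by induction from \<open>\<omega>(f\<^sub>1, f\<^sub>0) = 0\<close>.
  They say that \<open>f\<^sub>k\<^sub>+\<^sub>1\<close> and \<open>j f\<^sub>-\<^sub>k\<^sub>-\<^sub>1\<close> are already orthogonal to \<open>span {f\<^sub>k, j f\<^sub>-\<^sub>k}\<close>, so \<open>A'\<close> maps
  that plane onto \<open>span {f\<^sub>k\<^sub>+\<^sub>1, j f\<^sub>-\<^sub>k\<^sub>-\<^sub>1}\<close>. This identifies the bundles off a set of isolated
  points, and smooth frames extend the identity across them.
\<close>

section \<open>Smooth maps\<close>

lemma frechet_derivative_eqI:
  "(f has_derivative f') (at x) \<Longrightarrow> frechet_derivative f (at x) = f'"
  using frechet_derivative_at by metis

lemma frechet_derivative_cong_open: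
  assumes "open U" "x \<in> U" "\<And>y. y \<in> U \<Longrightarrow> f y = g y"
  shows "frechet_derivative f (at x) = frechet_derivative g (at x)"
proof -
  have "(f has_derivative f') (at x) \<longleftrightarrow> (g has_derivative f') (at x)" for f'
    using assms has_derivative_transform_within_open[of _ f' x UNIV U]
    by (metis (no_types, lifting))
  then show ?thesis
    by (simp add: frechet_derivative_def)
qed

text \<open>A derivative at a point depends only on nearby values, so openness of \<open>U\<close>
  lets agreement on \<open>U\<close> pass to derivatives of every order.\<close>

lemma Ck_on_cong:
  assumes "open U" "\<And>x. x \<in> U \<Longrightarrow> f x = g x"
  shows "Ck_on k U f \<longleftrightarrow> Ck_on k U g"
  using assms(2)
proof (induction k arbitrary: f g)
  case 0
  then show ?case
    by (simp cong: continuous_on_cong)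
next
  case (Suc k)
  have "frechet_derivative f (at x) X = frechet_derivative g (at x) X" if "x \<in> U" for x X
    using frechet_derivative_cong_open[OF assms(1) that] Suc.prems by metis
  then have "Ck_on k U (\<lambda>x. frechet_derivative f (at x) X) \<longleftrightarrow>
      Ck_on k U (\<lambda>x. frechet_derivative g (at x) X)" for X
    by (rule Suc.IH)
  moreover have "f differentiable_on U \<longleftrightarrow> g differentiable_on U"
    using Suc.prems unfolding differentiable_on_def differentiable_def
    by (metis has_derivative_transform)
  ultimately show ?case
    by simp
qed

lemma Ck_on_subset:
  assumes "V \<subseteq> U" "Ck_on k U f"
  shows "Ck_on k V f"
  using assms(2)
proof (induction k arbitrary: f)
  case 0
  then show ?case
    using assms(1) continuous_on_subset by auto
next
  case (Suc k)
  then show ?case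
    using assms(1) differentiable_on_subset by auto
qed

lemma Ck_on_SucD: "Ck_on (Suc k) U f \<Longrightarrow> Ck_on k U f"
proof (induction k arbitrary: f)
  case 0
  then show ?case
    by (simp add: differentiable_imp_continuous_on)
next
  case (Suc k)
  have "Ck_on k U (\<lambda>x. frechet_derivative f (at x) X)" for X
    using Suc.prems by (intro Suc.IH) simp
  then show ?case
    using Suc.prems by simp
qed

lemma Ck_on_const: "Ck_on k U (\<lambda>x. c)"
proof (induction k arbitrary: c)
  case (Suc k)
  then show ?case
    by (simp add: frechet_derivative_const)
qed simp

lemma Ck_on_Suc_has_derivative:
  assumes "open U" "Ck_on (Suc k) U f" "x \<in> U"
  shows "(f has_derivative frechet_derivative f (at x)) (at x)"
  using assms by (simp add: differentiable_on_eq_differentiable_at frechet_derivative_works)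

text \<open>Lets each closure rule below work with an explicit derivative formula, valid on
  \<open>U\<close>, in place of \<open>frechet_derivative\<close>.\<close>

lemma Ck_on_SucI:
  assumes "open U" "\<And>x. x \<in> U \<Longrightarrow> (f has_derivative f' x) (at x)"
    and "\<And>X. Ck_on k U (\<lambda>x. f' x X)"
  shows "Ck_on (Suc k) U f"
proof -
  have "frechet_derivative f (at x) X = f' x X" if "x \<in> U" for x X
    using frechet_derivative_eqI[OF assms(2)[OF that]] by simp
  then have "Ck_on k U (\<lambda>x. frechet_derivative f (at x) X)" for X
    using Ck_on_cong[OF assms(1), of "\<lambda>x. frechet_derivative f (at x) X" "\<lambda>x. f' x X"] assms(3)
    by blast
  moreover have "f differentiable_on U"
    using assms(1,2) by (auto simp: differentiable_on_eq_differentiable_at differentiable_def)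
  ultimately show ?thesis
    by simp
qed

lemma Ck_on_linear:
  assumes "open U" "bounded_linear L" "Ck_on k U f"
  shows "Ck_on k U (\<lambda>x. L (f x))"
  using assms(3)
proof (induction k arbitrary: f)
  case 0
  then show ?case
    using bounded_linear.continuous_on[OF assms(2)] by simp
next
  case (Suc k)
  show ?case
  proof (rule Ck_on_SucI[OF assms(1)])
    show "((\<lambda>x. L (f x)) has_derivative (\<lambda>X. L (frechet_derivative f (at x) X))) (at x)"
      if "x \<in> U" for x
      by (rule bounded_linear.has_derivative
          [OF assms(2) Ck_on_Suc_has_derivative[OF assms(1) Suc.prems that]])
    show "Ck_on k U (\<lambda>x. L (frechet_derivative f (at x) X))" for X
      using Suc.prems by (intro Suc.IH) simp
  qed
qed

lemma Ck_on_add: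
  assumes "open U" "Ck_on k U f" "Ck_on k U g"
  shows "Ck_on k U (\<lambda>x. f x + g x)"
  using assms(2,3)
proof (induction k arbitrary: f g)
  case 0
  then show ?case
    by (simp add: continuous_on_add)
next
  case (Suc k)
  show ?case
  proof (rule Ck_on_SucI[OF assms(1)])
    show "((\<lambda>x. f x + g x) has_derivative
        (\<lambda>X. frechet_derivative f (at x) X + frechet_derivative g (at x) X)) (at x)"
      if "x \<in> U" for x
      by (intro has_derivative_add Ck_on_Suc_has_derivative[OF assms(1) Suc.prems(1) that]
          Ck_on_Suc_has_derivative[OF assms(1) Suc.prems(2) that])
    show "Ck_on k U (\<lambda>x. frechet_derivative f (at x) X + frechet_derivative g (at x) X)" for X
      using Suc.prems by (intro Suc.IH) simp_all
  qed
qed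

text \<open>The Leibniz rule contains \<open>f\<close> and \<open>g\<close> themselves next to their
  derivatives. Hence the induction generalises over both maps, and \<open>Ck_on_SucD\<close> lowers
  the order of the undifferentiated factor.\<close>

lemma Ck_on_bilinear:
  assumes "open U" "bounded_bilinear B" "Ck_on k U f" "Ck_on k U g"
  shows "Ck_on k U (\<lambda>x. B (f x) (g x))"
  using assms(3,4)
proof (induction k arbitrary: f g)
  case 0
  then show ?case
    using bounded_bilinear.continuous_on[OF assms(2)] by simp
next
  case (Suc k)
  show ?case
  proof (rule Ck_on_SucI[OF assms(1)])
    show "((\<lambda>x. B (f x) (g x)) has_derivative
        (\<lambda>X. B (f x) (frechet_derivative g (at x) X) + B (frechet_derivative f (at x) X) (g x))) (at x)"
      if "x \<in> U" for x
      by (intro bounded_bilinear.FDERIV[OF assms(2)] 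
          Ck_on_Suc_has_derivative[OF assms(1) Suc.prems(1) that]
          Ck_on_Suc_has_derivative[OF assms(1) Suc.prems(2) that])
    show "Ck_on k U (\<lambda>x. B (f x) (frechet_derivative g (at x) X) + B (frechet_derivative f (at x) X) (g x))"
      for X
      using Suc.prems
      by (intro Ck_on_add[OF assms(1)] Suc.IH Ck_on_SucD[of k U f] Ck_on_SucD[of k U g]) simp_all
  qed
qed

text \<open>The derivative of \<open>1/f\<close> is a product of \<open>1/f\<close>,
  \<open>f'\<close> and \<open>1/f\<close>, so order \<open>k\<close> of \<open>1/f\<close> itself,
  which is the induction hypothesis, gives order \<open>k + 1\<close>.\<close>

lemma Ck_on_inverse:
  fixes f :: "'a::real_normed_vector \<Rightarrow> complex"
  assumes "open U" "\<And>x. x \<in> U \<Longrightarrow> f x \<noteq> 0" "Ck_on k U f"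
  shows "Ck_on k U (\<lambda>x. inverse (f x))"
  using assms(3)
proof (induction k)
  case 0
  then show ?case
    using assms(2) by (simp add: continuous_on_inverse)
next
  case (Suc k)
  note IH = Suc.IH[OF Ck_on_SucD[OF Suc.prems]]
  show ?case
  proof (rule Ck_on_SucI[OF assms(1)])
    show "((\<lambda>x. inverse (f x)) has_derivative
        (\<lambda>X. - (inverse (f x) * frechet_derivative f (at x) X * inverse (f x)))) (at x)"
      if "x \<in> U" for x
      by (rule Deriv.has_derivative_inverse
          [OF assms(2)[OF that] Ck_on_Suc_has_derivative[OF assms(1) Suc.prems that]])
    show "Ck_on k U (\<lambda>x. - (inverse (f x) * frechet_derivative f (at x) X * inverse (f x)))" for X
      using Suc.prems IH
      by (intro Ck_on_linear[OF assms(1) bounded_linear_minus[OF bounded_linear_ident]]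
          Ck_on_bilinear[OF assms(1) bounded_bilinear_mult]) simp_all
  qed
qed

section \<open>Closure properties of smooth maps\<close>

lemma smooth_on_cong:
  assumes "open U" "\<And>x. x \<in> U \<Longrightarrow> f x = g x"
  shows "smooth_on U f \<longleftrightarrow> smooth_on U g"
  unfolding smooth_on_def using Ck_on_cong[OF assms(1), of f g] assms(2) by blast

lemma smooth_on_subset: "smooth_on U f \<Longrightarrow> V \<subseteq> U \<Longrightarrow> smooth_on V f"
  unfolding smooth_on_def using Ck_on_subset by blast

lemma smooth_on_const: "smooth_on U (\<lambda>x. c)"
  by (simp add: smooth_on_def Ck_on_const)

lemma smooth_on_linear:
  "open U \<Longrightarrow> bounded_linear L \<Longrightarrow> smooth_on U f \<Longrightarrow> smooth_on U (\<lambda>x. L (f x))"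
  by (simp add: smooth_on_def Ck_on_linear)

lemma smooth_on_add:
  "open U \<Longrightarrow> smooth_on U f \<Longrightarrow> smooth_on U g \<Longrightarrow> smooth_on U (\<lambda>x. f x + g x)"
  by (simp add: smooth_on_def Ck_on_add)

lemma smooth_on_diff:
  assumes "open U" "smooth_on U f" "smooth_on U g"
  shows "smooth_on U (\<lambda>x. f x - g x)"
  using smooth_on_add[OF assms(1,2) smooth_on_linear
      [OF assms(1) bounded_linear_minus[OF bounded_linear_ident] assms(3)]]
  by simp

lemma smooth_on_bilinear:
  "open U \<Longrightarrow> bounded_bilinear B \<Longrightarrow> smooth_on U f \<Longrightarrow> smooth_on U g
    \<Longrightarrow> smooth_on U (\<lambda>x. B (f x) (g x))"
  by (simp add: smooth_on_def Ck_on_bilinear)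

lemma smooth_on_inverse:
  fixes f :: "'a::real_normed_vector \<Rightarrow> complex"
  shows "open U \<Longrightarrow> (\<And>x. x \<in> U \<Longrightarrow> f x \<noteq> 0) \<Longrightarrow> smooth_on U f
    \<Longrightarrow> smooth_on U (\<lambda>x. inverse (f x))"
  by (simp add: smooth_on_def Ck_on_inverse)

lemma smooth_on_frechet_derivative:
  "smooth_on U f \<Longrightarrow> smooth_on U (\<lambda>x. frechet_derivative f (at x) X)"
  unfolding smooth_on_def using Ck_on.simps(2) by blast

lemma smooth_on_has_derivative:
  "open U \<Longrightarrow> smooth_on U f \<Longrightarrow> x \<in> U \<Longrightarrow>
    (f has_derivative frechet_derivative f (at x)) (at x)"
  unfolding smooth_on_def using Ck_on_Suc_has_derivative by blast

lemma smooth_on_continuous_on: "smooth_on U f \<Longrightarrow> continuous_on U f"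
  unfolding smooth_on_def using Ck_on.simps(1) by blast

section \<open>Symmetry of second derivatives\<close>

text \<open>Two applications of the one-variable mean value theorem, first along \<open>X\<close>
  and then along \<open>Y\<close>. The left-hand side of the equation is symmetric in
  \<open>X\<close> and \<open>Y\<close> while the right-hand side is not visibly so; this drives the
  symmetry proof.\<close>

lemma second_difference_mvt:
  fixes f :: "'a::real_normed_vector \<Rightarrow> real"
  assumes U: "open U" and f: "smooth_on U f" and h: "0 < h"
    and sub: "\<And>t u. 0 \<le> t \<Longrightarrow> t \<le> h \<Longrightarrow> 0 \<le> u \<Longrightarrow> u \<le> h \<Longrightarrow> z + t *\<^sub>R X + u *\<^sub>R Y \<in> U"
  shows "\<exists>t u. 0 \<le> t \<and> t \<le> h \<and> 0 \<le> u \<and> u \<le> h \<and>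
    f (z + h *\<^sub>R X + h *\<^sub>R Y) - f (z + h *\<^sub>R X) - f (z + h *\<^sub>R Y) + f z =
    h * h * frechet_derivative (\<lambda>x. frechet_derivative f (at x) X) (at (z + t *\<^sub>R X + u *\<^sub>R Y)) Y"
proof -
  define fX where "fX = (\<lambda>x. frechet_derivative f (at x) X)"
  have fX: "smooth_on U fX"
    unfolding fX_def by (rule smooth_on_frechet_derivative[OF f])
  have d1: "((\<lambda>t. f (z + t *\<^sub>R X + u *\<^sub>R Y)) has_real_derivative fX (z + t *\<^sub>R X + u *\<^sub>R Y)) (at t)"
    if "0 \<le> t" "t \<le> h" "0 \<le> u" "u \<le> h" for t u
  proof -
    note D = smooth_on_has_derivative[OF U f sub[OF that]]
    have "((\<lambda>t. f (z + t *\<^sub>R X + u *\<^sub>R Y)) has_derivative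
        (\<lambda>r. frechet_derivative f (at (z + t *\<^sub>R X + u *\<^sub>R Y)) (r *\<^sub>R X))) (at t)"
      by (rule has_derivative_compose[where f="\<lambda>t. z + t *\<^sub>R X + u *\<^sub>R Y", OF _ D])
        (auto intro!: derivative_eq_intros)
    then show ?thesis
      using linear_scale[OF has_derivative_linear[OF D]]
      by (simp add: has_field_derivative_def fX_def mult_commute_abs)
  qed
  have d2: "((\<lambda>u. fX (z + t *\<^sub>R X + u *\<^sub>R Y)) has_real_derivative
      frechet_derivative fX (at (z + t *\<^sub>R X + u *\<^sub>R Y)) Y) (at u)"
    if "0 \<le> t" "t \<le> h" "0 \<le> u" "u \<le> h" for t u
  proof -
    note D = smooth_on_has_derivative[OF U fX sub[OF that]]
    have "((\<lambda>u. fX (z + t *\<^sub>R X + u *\<^sub>R Y)) has_derivative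
        (\<lambda>r. frechet_derivative fX (at (z + t *\<^sub>R X + u *\<^sub>R Y)) (r *\<^sub>R Y))) (at u)"
      by (rule has_derivative_compose[where f="\<lambda>u. z + t *\<^sub>R X + u *\<^sub>R Y", OF _ D])
        (auto intro!: derivative_eq_intros)
    then show ?thesis
      using linear_scale[OF has_derivative_linear[OF D]]
      by (simp add: has_field_derivative_def mult_commute_abs)
  qed
  \<comment> \<open>The difference in direction \<open>Y\<close> as a function of the step along
    \<open>X\<close>; the summand with factor 0 is kept so that \<open>d1\<close> applies to both
    terms.\<close>
  define p where "p = (\<lambda>t. f (z + t *\<^sub>R X + h *\<^sub>R Y) - f (z + t *\<^sub>R X + 0 *\<^sub>R Y))"
  have "DERIV p t :> fX (z + t *\<^sub>R X + h *\<^sub>R Y) - fX (z + t *\<^sub>R X + 0 *\<^sub>R Y)"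
    if "0 \<le> t" "t \<le> h" for t
    unfolding p_def using that h by (intro DERIV_diff d1) simp_all
  from MVT2[OF h this] obtain t where t: "0 < t" "t < h" and
    eq1: "p h - p 0 = (h - 0) * (fX (z + t *\<^sub>R X + h *\<^sub>R Y) - fX (z + t *\<^sub>R X + 0 *\<^sub>R Y))"
    by blast
  define q where "q = (\<lambda>u. fX (z + t *\<^sub>R X + u *\<^sub>R Y))"
  have "DERIV q u :> frechet_derivative fX (at (z + t *\<^sub>R X + u *\<^sub>R Y)) Y"
    if "0 \<le> u" "u \<le> h" for u
    unfolding q_def using that t by (intro d2) simp_all
  from MVT2[OF h this] obtain u where u: "0 < u" "u < h" and
    eq2: "q h - q 0 = (h - 0) * frechet_derivative fX (at (z + t *\<^sub>R X + u *\<^sub>R Y)) Y"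
    by blast
  have "p h - p 0 = h * h * frechet_derivative fX (at (z + t *\<^sub>R X + u *\<^sub>R Y)) Y"
    unfolding eq1 using eq2 by (simp add: q_def)
  then have "f (z + h *\<^sub>R X + h *\<^sub>R Y) - f (z + h *\<^sub>R X) - f (z + h *\<^sub>R Y) + f z
      = h * h * frechet_derivative fX (at (z + t *\<^sub>R X + u *\<^sub>R Y)) Y"
    by (simp add: p_def)
  then show ?thesis
    using t u unfolding fX_def by (intro exI[of _ t] exI[of _ u] conjI less_imp_le)
qed

text \<open>The intermediate points of the mean value theorem tend to \<open>z\<close>, and the
  mixed second derivative is continuous.\<close>

lemma second_difference_limit:
  fixes f :: "'a::real_normed_vector \<Rightarrow> real"
  assumes U: "open U" and f: "smooth_on U f" and z: "z \<in> U"
  shows "((\<lambda>h. (f (z + h *\<^sub>R X + h *\<^sub>R Y) - f (z + h *\<^sub>R X) - f (z + h *\<^sub>R Y) + f z) / (h * h))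
    \<longlongrightarrow> frechet_derivative (\<lambda>x. frechet_derivative f (at x) X) (at z) Y) (at_right 0)"
proof -
  define G where "G = (\<lambda>x. frechet_derivative (\<lambda>x. frechet_derivative f (at x) X) (at x) Y)"
  have "continuous_on U G"
    unfolding G_def by (intro smooth_on_continuous_on smooth_on_frechet_derivative f)
  then have cont: "isCont G z"
    using U z continuous_on_eq_continuous_at by blast
  show ?thesis
  proof (rule tendstoI)
    fix r :: real
    assume r: "0 < r"
    obtain d1 where d1: "d1 > 0" "\<And>x. dist x z < d1 \<Longrightarrow> dist (G x) (G z) < r"
      using cont r unfolding continuous_at_eps_delta by blast
    obtain d2 where d2: "d2 > 0" "ball z d2 \<subseteq> U"
      using U z open_contains_ball by blast
    \<comment> \<open>A point of the parallelogram of size \<open>h\<close> lies within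
      \<open>h * (norm X + norm Y)\<close> of \<open>z\<close>, so \<open>h < d\<close> keeps it
      within \<open>min d1 d2\<close>; the added 1 keeps the denominator positive when
      \<open>X\<close> and \<open>Y\<close> vanish.\<close>
    define d where "d = min d1 d2 / (norm X + norm Y + 1)"
    have pos: "norm X + norm Y + 1 > 0"
      by (simp add: add_nonneg_pos)
    have d: "d > 0"
      using d1 d2 pos by (simp add: d_def)
    have near: "dist (z + t *\<^sub>R X + u *\<^sub>R Y) z < min d1 d2"
      if "0 \<le> t" "t \<le> h" "0 \<le> u" "u \<le> h" "0 < h" "h < d" for t u h
    proof -
      have "dist (z + t *\<^sub>R X + u *\<^sub>R Y) z \<le> t * norm X + u * norm Y"
        using that norm_triangle_ineq[of "t *\<^sub>R X" "u *\<^sub>R Y"] by (simp add: dist_norm add.assoc)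
      also have "\<dots> \<le> h * norm X + h * norm Y"
        using that by (intro add_mono mult_right_mono) auto
      also have "\<dots> < h * (norm X + norm Y + 1)"
        using that by (simp add: algebra_simps)
      also have "\<dots> < d * (norm X + norm Y + 1)"
        using that pos by (intro mult_strict_right_mono) auto
      also have "\<dots> = min d1 d2"
        using pos by (simp add: d_def)
      finally show ?thesis .
    qed
    have "dist ((f (z + h *\<^sub>R X + h *\<^sub>R Y) - f (z + h *\<^sub>R X) - f (z + h *\<^sub>R Y) + f z) / (h * h)) (G z) < r"
      if h: "0 < h" "h < d" for h
    proof -
      have "z + t *\<^sub>R X + u *\<^sub>R Y \<in> U" if "0 \<le> t" "t \<le> h" "0 \<le> u" "u \<le> h" for t u
        using near[OF that h] by (intro subsetD[OF d2(2)]) (simp add: dist_commute)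
      note mvt = second_difference_mvt[OF U f h(1) this]
      obtain t u where tu: "0 \<le> t" "t \<le> h" "0 \<le> u" "u \<le> h"
        and eq: "f (z + h *\<^sub>R X + h *\<^sub>R Y) - f (z + h *\<^sub>R X) - f (z + h *\<^sub>R Y) + f z
          = h * h * G (z + t *\<^sub>R X + u *\<^sub>R Y)"
        unfolding G_def using mvt by blast
      show ?thesis
        unfolding eq using d1(2)[of "z + t *\<^sub>R X + u *\<^sub>R Y"] near[OF tu h] h by simp
    qed
    then have "\<forall>\<^sub>F h in at_right 0.
        dist ((f (z + h *\<^sub>R X + h *\<^sub>R Y) - f (z + h *\<^sub>R X) - f (z + h *\<^sub>R Y) + f z) / (h * h)) (G z) < r"
      by (intro eventually_at_rightI[OF _ d]) simp
    then show "\<forall>\<^sub>F h in at_right 0.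
        dist ((f (z + h *\<^sub>R X + h *\<^sub>R Y) - f (z + h *\<^sub>R X) - f (z + h *\<^sub>R Y) + f z) / (h * h))
          (frechet_derivative (\<lambda>x. frechet_derivative f (at x) X) (at z) Y) < r"
      unfolding G_def .
  qed
qed

text \<open>Exchanging \<open>X\<close> and \<open>Y\<close> does not change the second difference,
  and its limit is unique.\<close>

lemma frechet_derivative_commute_real:
  fixes f :: "'a::real_normed_vector \<Rightarrow> real"
  assumes "open U" "smooth_on U f" "z \<in> U"
  shows "frechet_derivative (\<lambda>x. frechet_derivative f (at x) X) (at z) Y
    = frechet_derivative (\<lambda>x. frechet_derivative f (at x) Y) (at z) X"
proof -
  define \<Delta> where "\<Delta> = (\<lambda>h X Y.
    (f (z + h *\<^sub>R X + h *\<^sub>R Y) - f (z + h *\<^sub>R X) - f (z + h *\<^sub>R Y) + f z) / (h * h))"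
  have lim: "((\<lambda>h. \<Delta> h X Y) \<longlongrightarrow>
      frechet_derivative (\<lambda>x. frechet_derivative f (at x) X) (at z) Y) (at_right 0)" for X Y
    unfolding \<Delta>_def by (rule second_difference_limit[OF assms])
  have "z + h *\<^sub>R Y + h *\<^sub>R X = z + h *\<^sub>R X + h *\<^sub>R Y" for h
    by (simp only: add_ac)
  then have "\<Delta> h Y X = \<Delta> h X Y" for h
    unfolding \<Delta>_def by (simp only:) simp
  then have "(\<lambda>h. \<Delta> h Y X) = (\<lambda>h. \<Delta> h X Y)"
    by (rule ext)
  then show ?thesis
    using lim[of Y X] by (intro tendsto_unique[OF trivial_limit_at_right_real lim]) simp
qed

lemma frechet_derivative_inner_left:
  assumes "(f has_derivative f') (at x)"
  shows "frechet_derivative (\<lambda>x. f x \<bullet> b) (at x) X = f' X \<bullet> b"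
  unfolding frechet_derivative_eqI[OF has_derivative_inner_left[OF assms]] ..

text \<open>The mean value theorem is about real functions, so the vector case is read off from the
  components along basis vectors.\<close>

lemma frechet_derivative_commute:
  fixes f :: "'a::real_normed_vector \<Rightarrow> 'b::euclidean_space"
  assumes U: "open U" and f: "smooth_on U f" and z: "z \<in> U"
  shows "frechet_derivative (\<lambda>x. frechet_derivative f (at x) X) (at z) Y
    = frechet_derivative (\<lambda>x. frechet_derivative f (at x) Y) (at z) X"
proof (rule euclidean_eqI)
  fix b :: 'b
  define D where "D = (\<lambda>X x. frechet_derivative f (at x) X)"
  have D: "smooth_on U (D X)" for X
    unfolding D_def by (rule smooth_on_frechet_derivative[OF f])
  define fb where "fb = (\<lambda>x. f x \<bullet> b)"
  have fb: "smooth_on U fb"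
    unfolding fb_def by (rule smooth_on_linear[OF U bounded_linear_inner_left f])
  have 1: "frechet_derivative fb (at x) X = D X x \<bullet> b" if "x \<in> U" for x X
    unfolding fb_def D_def
    by (rule frechet_derivative_inner_left[OF smooth_on_has_derivative[OF U f that]])
  have 2: "frechet_derivative (\<lambda>x. frechet_derivative fb (at x) X) (at z)
      = frechet_derivative (\<lambda>x. D X x \<bullet> b) (at z)" for X
    by (rule frechet_derivative_cong_open[OF U z 1])
  have 3: "frechet_derivative (\<lambda>x. D X x \<bullet> b) (at z) Y = frechet_derivative (D X) (at z) Y \<bullet> b" for X Y
    by (rule frechet_derivative_inner_left[OF smooth_on_has_derivative[OF U D z]])
  have "frechet_derivative (D X) (at z) Y \<bullet> b = frechet_derivative (D Y) (at z) X \<bullet> b"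
    using frechet_derivative_commute_real[OF U fb z, of X Y] unfolding 2 3 .
  then show "frechet_derivative (\<lambda>x. frechet_derivative f (at x) X) (at z) Y \<bullet> b
    = frechet_derivative (\<lambda>x. frechet_derivative f (at x) Y) (at z) X \<bullet> b"
    unfolding D_def .
qed

section \<open>Hermitian and quaternionic algebra\<close>

lemma herm_add_left: "herm (u + v) w = herm u w + herm v w"
  by (simp add: herm_def algebra_simps sum.distrib)

lemma herm_add_right: "herm w (u + v) = herm w u + herm w v"
  by (simp add: herm_def algebra_simps sum.distrib)

lemma herm_diff_left: "herm (u - v) w = herm u w - herm v w"
  by (simp add: herm_def algebra_simps sum_subtractf)

lemma herm_diff_right: "herm w (u - v) = herm w u - herm w v"
  by (simp add: herm_def algebra_simps sum_subtractf)

lemma herm_scale_left: "herm (c *s v) w = c * herm v w"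
  by (simp add: herm_def sum_distrib_left mult.assoc)

lemma herm_scale_right: "herm v (c *s w) = cnj c * herm v w"
  by (simp add: herm_def sum_distrib_left mult_ac)

lemma herm_scaleR_left: "herm (r *\<^sub>R v) w = r *\<^sub>R herm v w"
  by (simp add: herm_def scaleR_sum_right)

lemma herm_scaleR_right: "herm v (r *\<^sub>R w) = r *\<^sub>R herm v w"
  by (simp add: herm_def scaleR_sum_right)

lemma herm_zero_left [simp]: "herm 0 w = 0"
  by (simp add: herm_def)

lemma herm_zero_right [simp]: "herm v 0 = 0"
  by (simp add: herm_def)

lemmas herm_simps = herm_add_left herm_add_right herm_diff_left herm_diff_right
  herm_scale_left herm_scale_right

lemma cnj_herm: "cnj (herm v w) = herm w v"
  by (simp add: herm_def mult.commute)

lemma herm_eq_0_sym: "herm v w = 0 \<longleftrightarrow> herm w v = 0"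
  by (metis cnj_herm complex_cnj_zero_iff)

lemma Re_herm: "Re (herm v w) = v \<bullet> w"
  by (simp add: herm_def inner_vec_def inner_complex_def)

lemma herm_self: "herm v v = of_real ((norm v)\<^sup>2)"
proof -
  have "Im (herm v v) = 0"
    using cnj_herm[of v v] by (simp add: complex_eq_iff)
  then show ?thesis
    by (simp add: complex_eq_iff Re_herm power2_norm_eq_inner)
qed

lemma herm_self_eq_0 [simp]: "herm v v = 0 \<longleftrightarrow> v = 0"
  by (simp add: herm_self)

lemma bounded_bilinear_herm: "bounded_bilinear herm"
  unfolding bilinear_conv_bounded_bilinear[symmetric] bilinear_def
  by (intro conjI allI linearI)
    (simp_all add: herm_add_left herm_add_right herm_scaleR_left herm_scaleR_right)

lemma bounded_bilinear_vector_scalar_mult: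
  "bounded_bilinear (\<lambda>(c::complex) (v::'m::finite cvec). c *s v)"
  unfolding bilinear_conv_bounded_bilinear[symmetric] bilinear_def
  by (intro conjI allI linearI) (simp_all add: vec_eq_iff algebra_simps)

section \<open>Left multiplication by j\<close>

lemma sum_prod_2: "(\<Sum>p\<in>UNIV. f p) = (\<Sum>a\<in>UNIV. f (a, 1) + f (a, 2::2))"
  by (simp add: sum_2 sum.cartesian_product' flip: UNIV_Times_UNIV)

lemma jmul_nth [simp]: "jmul v $ (a, 1) = - cnj (v $ (a, 2))" "jmul v $ (a, 2) = cnj (v $ (a, 1))"
  by (simp_all add: jmul_def)

lemma cvec_eq_iff: "v = w \<longleftrightarrow> (\<forall>a. v $ (a, 1) = w $ (a, 1) \<and> v $ (a, 2::2) = w $ (a, 2))"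
  by (auto simp: vec_eq_iff forall_2)

lemma jmul_add: "jmul (v + w) = jmul v + jmul w"
  by (simp add: cvec_eq_iff)

lemma jmul_diff: "jmul (v - w) = jmul v - jmul w"
  by (simp add: cvec_eq_iff)

lemma jmul_scale: "jmul (c *s v) = cnj c *s jmul v"
  by (simp add: cvec_eq_iff)

lemma jmul_jmul [simp]: "jmul (jmul v) = - v"
  by (simp add: cvec_eq_iff)

lemma jmul_zero [simp]: "jmul 0 = 0"
  by (simp add: cvec_eq_iff)

lemma jmul_eq_0 [simp]: "jmul v = 0 \<longleftrightarrow> v = 0"
  by (metis jmul_jmul jmul_zero neg_equal_0_iff_equal)

lemma bounded_linear_jmul: "bounded_linear jmul"
  unfolding linear_conv_bounded_linear[symmetric]
  by (intro linearI) (simp_all add: cvec_eq_iff)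

lemma herm_jmul_jmul: "herm (jmul v) (jmul w) = herm w v"
  unfolding herm_def by (simp add: sum_prod_2 algebra_simps)

text \<open>Skew-symmetry of the form \<omega>; it makes \<open>herm v (jmul v)\<close> vanish and
  allows the two arguments of a relation to be exchanged.\<close>

lemma herm_jmul_right: "herm v (jmul w) = - herm w (jmul v)"
  unfolding herm_def by (simp add: sum_prod_2 algebra_simps flip: sum_negf)

lemma herm_jmul_left: "herm (jmul v) w = cnj (herm w (jmul v))"
  by (simp add: cnj_herm)

lemma herm_jmul_self [simp]: "herm v (jmul v) = 0"
  using herm_jmul_right[of v v] by simp

section \<open>Orthogonal projections and spans of one or two vectors\<close>

text \<open>\<open>proj\<close> is a definite description, so it is evaluated by exhibiting the
  projection; two candidates differ by a vector of \<open>W\<close> that is orthogonal to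
  itself.\<close>

lemma proj_eqI:
  assumes "vec.subspace W" "p \<in> W" "\<And>w. w \<in> W \<Longrightarrow> herm (v - p) w = 0"
  shows "proj W v = p"
  unfolding proj_def
proof (rule the_equality)
  fix q assume q: "q \<in> W \<and> (\<forall>w\<in>W. herm (v - q) w = 0)"
  have "p - q \<in> W"
    using assms(1,2) q vec.subspace_diff by blast
  then have "herm (v - q) (p - q) - herm (v - p) (p - q) = 0"
    using assms(3) q by simp
  then have "herm (p - q) (p - q) = 0"
    by (simp flip: herm_diff_left)
  then show "q = p"
    by simp
qed (use assms in auto)

lemma perp_eqI:
  assumes "vec.subspace W" "v - r \<in> W" "\<And>w. w \<in> W \<Longrightarrow> herm r w = 0"
  shows "perp W v = r"
  unfolding perp_def using proj_eqI[OF assms(1,2)] assms(3) by simp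

lemma cp_eq: "cp q = range (\<lambda>c. c *s q)"
  by (simp add: cp_def vec.span_singleton)

lemma span_pair: "vec.span {a, b} = {c *s a + d *s b |c d. True}"
  for a b :: "complex ^ 'n"
proof (intro subset_antisym subsetI)
  fix x assume "x \<in> vec.span {a, b}"
  then obtain c d where "x - c *s a = d *s b"
    unfolding vec.span_insert[of a] vec.span_singleton by blast
  then have "x = c *s a + d *s b"
    by (simp add: diff_eq_eq add.commute)
  then show "x \<in> {c *s a + d *s b |c d. True}"
    by blast
qed (auto intro: vec.span_add[OF vec.span_scale[OF vec.span_base] vec.span_scale[OF vec.span_base]])


section \<open>The complex derivatives of vector-valued and scalar functions\<close>

text \<open>\<open>e = 1\<close> gives \<open>\<partial>\<^sub>z\<close> and \<open>e = -1\<close> gives its conjugate, so that both halves of a harmonic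
  sequence are treated at once.\<close>

definition wd :: "real \<Rightarrow> (complex \<Rightarrow> 'm::finite cvec) \<Rightarrow> complex \<Rightarrow> 'm cvec" where
  "wd e v z = (1/2) *s (dd v 1 z - (of_real e * \<i>) *s dd v \<i> z)"

definition cd :: "real \<Rightarrow> (complex \<Rightarrow> complex) \<Rightarrow> complex \<Rightarrow> complex" where
  "cd e h z = (1/2) * (frechet_derivative h (at z) 1 - of_real e * \<i> * frechet_derivative h (at z) \<i>)"

lemma dz_eq_wd: "dz = wd 1"
  by (simp add: fun_eq_iff dz_def wd_def)

lemma dzbar_eq_wd: "dzbar = wd (- 1)"
  by (simp add: fun_eq_iff dzbar_def wd_def)

lemma wd_cong:
  assumes "open U" "z \<in> U" "\<And>w. w \<in> U \<Longrightarrow> v w = u w"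
  shows "wd e v z = wd e u z"
  using frechet_derivative_cong_open[OF assms(1,2), of v u] assms(3) by (simp add: wd_def dd_def)

lemma wd_diff:
  assumes "v differentiable at z" "u differentiable at z"
  shows "wd e (\<lambda>w. v w - u w) z = wd e v z - wd e u z"
proof -
  have "frechet_derivative (\<lambda>w. v w - u w) (at z)
      = (\<lambda>X. frechet_derivative v (at z) X - frechet_derivative u (at z) X)"
    using assms by (intro frechet_derivative_eqI has_derivative_diff)
      (simp_all flip: frechet_derivative_works)
  then show ?thesis
    by (simp add: wd_def dd_def vec_eq_iff algebra_simps)
qed

lemma wd_add:
  assumes "v differentiable at z" "u differentiable at z"
  shows "wd e (\<lambda>w. v w + u w) z = wd e v z + wd e u z"
proof -
  have "frechet_derivative (\<lambda>w. v w + u w) (at z)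
      = (\<lambda>X. frechet_derivative v (at z) X + frechet_derivative u (at z) X)"
    using assms by (intro frechet_derivative_eqI has_derivative_add)
      (simp_all flip: frechet_derivative_works)
  then show ?thesis
    by (simp add: wd_def dd_def vec_eq_iff algebra_simps)
qed

lemma wd_scale:
  assumes "h differentiable at z" "v differentiable at z"
  shows "wd e (\<lambda>w. h w *s v w) z = cd e h z *s v z + h z *s wd e v z"
proof -
  have "frechet_derivative (\<lambda>w. h w *s v w) (at z)
      = (\<lambda>X. h z *s frechet_derivative v (at z) X + frechet_derivative h (at z) X *s v z)"
    using assms
    by (intro frechet_derivative_eqI bounded_bilinear.FDERIV[OF bounded_bilinear_vector_scalar_mult])
      (simp_all flip: frechet_derivative_works)
  then show ?thesis
    by (simp add: wd_def cd_def dd_def vec_eq_iff algebra_simps)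
qed

lemma differentiable_linear:
  assumes "bounded_linear L" "f differentiable at z"
  shows "(\<lambda>w. L (f w)) differentiable at z"
  by (rule differentiableI[OF bounded_linear.has_derivative[OF assms(1)
          assms(2)[unfolded frechet_derivative_works]]])

text \<open>Being conjugate-linear, j changes the sign of \<open>\<i>\<close> and so exchanges
  \<partial>' and \<partial>''. This is why j carries the downward sequence into upward
  derivatives.\<close>

lemma wd_jmul:
  assumes "v differentiable at z"
  shows "wd e (\<lambda>w. jmul (v w)) z = jmul (wd (- e) v z)"
proof -
  have "frechet_derivative (\<lambda>w. jmul (v w)) (at z) = (\<lambda>X. jmul (frechet_derivative v (at z) X))"
    using assms
    by (intro frechet_derivative_eqI bounded_linear.has_derivative[OF bounded_linear_jmul])
      (simp flip: frechet_derivative_works)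
  then show ?thesis
    by (simp add: wd_def dd_def jmul_add jmul_diff jmul_scale)
qed

text \<open>Leibniz rule for an identity that holds near \<open>z\<close>; conjugation in the second
  argument of \<open>herm\<close> turns \<open>e\<close> into \<open>- e\<close> there.\<close>

lemma wd_herm_zero:
  assumes "open U" "z \<in> U" "\<And>w. w \<in> U \<Longrightarrow> herm (v w) (u w) = 0"
    and "v differentiable at z" "u differentiable at z"
  shows "herm (wd e v z) (u z) + herm (v z) (wd (- e) u z) = 0"
proof -
  have "frechet_derivative (\<lambda>w. herm (v w) (u w)) (at z)
      = (\<lambda>X. herm (v z) (frechet_derivative u (at z) X) + herm (frechet_derivative v (at z) X) (u z))"
    using assms(4,5)
    by (intro frechet_derivative_eqI bounded_bilinear.FDERIV[OF bounded_bilinear_herm])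
      (simp_all flip: frechet_derivative_works)
  moreover have "frechet_derivative (\<lambda>w. herm (v w) (u w)) (at z)
      = frechet_derivative (\<lambda>w. 0) (at z)"
    by (rule frechet_derivative_cong_open[OF assms(1,2)]) (rule assms(3))
  ultimately have
    "herm (v z) (frechet_derivative u (at z) X) + herm (frechet_derivative v (at z) X) (u z) = 0" for X
    by (metis frechet_derivative_const)
  then have *: "herm (frechet_derivative v (at z) X) (u z) = - herm (v z) (frechet_derivative u (at z) X)"
    for X
    by (simp add: eq_neg_iff_add_eq_0 add.commute)
  show ?thesis
    by (simp add: wd_def dd_def herm_simps *)
qed

text \<open>The sign changes from \<open>herm\<close> and from j cancel, as \<omega> is complex
  bilinear, so the same operator acts on both arguments.\<close>

lemma wd_herm_jmul_zero:
  assumes "open U" "z \<in> U" "\<And>w. w \<in> U \<Longrightarrow> herm (v w) (jmul (u w)) = 0"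
    and "v differentiable at z" "u differentiable at z"
  shows "herm (wd e v z) (jmul (u z)) + herm (v z) (jmul (wd e u z)) = 0"
proof -
  have "(\<lambda>w. jmul (u w)) differentiable at z"
    by (rule differentiable_linear[OF bounded_linear_jmul assms(5)])
  from wd_herm_zero[OF assms(1-4) this, of e] show ?thesis
    by (simp add: wd_jmul[OF assms(5)])
qed

lemma smooth_on_differentiable:
  "open U \<Longrightarrow> smooth_on U f \<Longrightarrow> x \<in> U \<Longrightarrow> f differentiable at x"
  by (rule differentiableI[OF smooth_on_has_derivative])

lemma smooth_on_scale:
  "open U \<Longrightarrow> smooth_on U h \<Longrightarrow> smooth_on U v \<Longrightarrow> smooth_on U (\<lambda>z. h z *s v z)"
  for v :: "'a::real_normed_vector \<Rightarrow> 'm::finite cvec"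
  by (rule smooth_on_bilinear[OF _ bounded_bilinear_vector_scalar_mult])

lemma smooth_on_herm:
  "open U \<Longrightarrow> smooth_on U u \<Longrightarrow> smooth_on U v \<Longrightarrow> smooth_on U (\<lambda>z. herm (u z) (v z))"
  by (rule smooth_on_bilinear[OF _ bounded_bilinear_herm])

lemma smooth_on_mult:
  fixes f g :: "'a::real_normed_vector \<Rightarrow> complex"
  shows "open U \<Longrightarrow> smooth_on U f \<Longrightarrow> smooth_on U g \<Longrightarrow> smooth_on U (\<lambda>z. f z * g z)"
  by (rule smooth_on_bilinear[OF _ bounded_bilinear_mult])

lemma smooth_on_wd:
  assumes "open U" "smooth_on U v"
  shows "smooth_on U (wd e v)"
  unfolding wd_def[abs_def] dd_def
  by (intro smooth_on_scale smooth_on_diff smooth_on_const smooth_on_frechet_derivative assms)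

text \<open>The right-hand side depends only on \<open>a + b\<close> and \<open>a * b\<close>, which
  gives \<open>wd_commute\<close>. For \<open>a = - e\<close>, \<open>b = e\<close> and
  \<open>e * e = 1\<close> it is a quarter of the Laplacian, which links \<open>wd\<close> to the
  tension field.\<close>

lemma wd_wd:
  assumes "open U" "smooth_on U v" "z \<in> U"
  shows "wd a (wd b v) z = (1/4) *s (dd (dd v 1) 1 z - (of_real (a + b) * \<i>) *s dd (dd v 1) \<i> z
    - of_real (a * b) *s dd (dd v \<i>) \<i> z)"
proof -
  have D: "dd v X differentiable at z" for X
    unfolding dd_def[abs_def]
    by (intro smooth_on_differentiable[OF assms(1) smooth_on_frechet_derivative] assms)
  have k: "(\<lambda>w. c) differentiable at z" for c :: complex
    by simp
  have cd0: "cd e (\<lambda>w. c) z = 0" for e c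
    by (simp add: cd_def frechet_derivative_const)
  have sc: "(\<lambda>w. c *s dd v X w) differentiable at z" for c X
    by (rule differentiable_linear[OF bounded_bilinear.bounded_linear_right
          [OF bounded_bilinear_vector_scalar_mult] D])
  have df: "(\<lambda>w. dd v 1 w - c *s dd v \<i> w) differentiable at z" for c
    by (intro differentiable_diff sc D)
  have "wd b v = (\<lambda>w. (1/2) *s (dd v 1 w - (of_real b * \<i>) *s dd v \<i> w))"
    by (simp add: fun_eq_iff wd_def)
  then have eq: "wd a (wd b v) z
      = (1/2) *s (wd a (dd v 1) z - (of_real b * \<i>) *s wd a (dd v \<i>) z)"
    by (simp only: wd_scale[OF k df] wd_scale[OF k D] wd_diff[OF D sc] cd0) simp
  have "dd (dd v \<i>) 1 z = dd (dd v 1) \<i> z"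
    unfolding dd_def[abs_def] by (rule frechet_derivative_commute[OF assms])
  then show ?thesis
    unfolding eq by (simp add: wd_def vec_eq_iff algebra_simps)
qed

lemma wd_commute:
  assumes "open U" "smooth_on U v" "z \<in> U"
  shows "wd a (wd b v) z = wd b (wd a v) z"
  unfolding wd_wd[OF assms] by (simp add: add.commute mult.commute)

section \<open>The sections of a harmonic sequence\<close>

text \<open>Common form of \<open>f_up\<close> and \<open>f_down\<close>, so that one argument
  serves both directions.\<close>

primrec fs :: "real \<Rightarrow> (complex \<Rightarrow> 'm::finite cvec) \<Rightarrow> nat \<Rightarrow> complex \<Rightarrow> 'm cvec" where
  "fs e s 0 = s"
| "fs e s (Suc k) = (\<lambda>z. if fs e s k z = 0 then 0
     else wd e (fs e s k) z
       - (herm (wd e (fs e s k) z) (fs e s k z) / of_real ((norm (fs e s k z))\<^sup>2)) *s fs e s k z)"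

lemma f_up_eq_fs: "f_up s k = fs 1 s k"
  by (induction k) (simp_all add: dz_eq_wd cong: if_cong)

lemma f_down_eq_fs: "f_down s k = fs (- 1) s k"
  by (induction k) (simp_all add: dzbar_eq_wd cong: if_cong)

text \<open>One Gram-Schmidt step; at zeros of \<open>fs e s k\<close> the default value 0 makes it
  hold as well.\<close>

lemma fs_orthogonal: "herm (fs e s (Suc k) z) (fs e s k z) = 0"
  by (simp add: herm_diff_left herm_scale_left herm_self)

text \<open>The quotient of the recursion, written with \<open>herm\<close> and a complex
  \<open>inverse\<close> so that the closure rules for smooth maps apply to it.\<close>

definition fs_coeff :: "real \<Rightarrow> (complex \<Rightarrow> 'm::finite cvec) \<Rightarrow> nat \<Rightarrow> complex \<Rightarrow> complex" where
  "fs_coeff e s k z = herm (wd e (fs e s k) z) (fs e s k z) * inverse (herm (fs e s k z) (fs e s k z))"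

lemma fs_Suc_eq:
  "fs e s k z \<noteq> 0 \<Longrightarrow> fs e s (Suc k) z = wd e (fs e s k) z - fs_coeff e s k z *s fs e s k z"
  by (simp add: fs_coeff_def herm_self divide_inverse)

lemma wd_fs_eq:
  "fs e s k z \<noteq> 0 \<Longrightarrow> wd e (fs e s k) z = fs e s (Suc k) z + fs_coeff e s k z *s fs e s k z"
  using fs_Suc_eq[of e s k z] by simp

text \<open>The properties of the lift from which the orthogonality relations follow, in terms of
  \<open>wd\<close>: \<open>harmonic\<close> expresses minimality, and \<open>conformal\<close> says
  that \<partial>'s and \<partial>''s are orthogonal.\<close>

locale horizontal_harmonic_lift =
  fixes M :: "complex set" and s :: "complex \<Rightarrow> 'm::finite cvec"
  assumes open_M: "open M" and smooth_s: "smooth_on M s"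
    and s_nonzero: "z \<in> M \<Longrightarrow> s z \<noteq> 0"
    and horizontal: "z \<in> M \<Longrightarrow> herm (wd e s z) (s z) = 0"
    and horizontal_j: "z \<in> M \<Longrightarrow> herm (wd e s z) (jmul (s z)) = 0"
    and harmonic: "e * e = 1 \<Longrightarrow> z \<in> M \<Longrightarrow> \<exists>c. wd (- e) (wd e s) z = c *s s z"
    and conformal: "e * e = 1 \<Longrightarrow> z \<in> M \<Longrightarrow> herm (wd e s z) (wd (- e) s z) = 0"
begin

text \<open>The set where the recursion for the next section is a genuine quotient. Zeros persist
  along the recursion, so these sets decrease in \<open>k\<close>.\<close>

definition N :: "real \<Rightarrow> nat \<Rightarrow> complex set" where
  "N e k = {z \<in> M. fs e s k z \<noteq> 0}"

lemma N_0: "N e 0 = M"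
  using s_nonzero by (auto simp: N_def)

lemma N_Suc_subset: "N e (Suc k) \<subseteq> N e k"
  by (auto simp: N_def)

text \<open>Openness and smoothness need each other: the next section is smooth on
  \<open>N e k\<close>, and \<open>N e (Suc k)\<close> is the part of \<open>N e k\<close> where
  this continuous map is nonzero.\<close>

lemma open_N_smooth:
  "open (N e k) \<and> smooth_on (N e k) (fs e s k) \<and> smooth_on (N e k) (fs_coeff e s k)
    \<and> smooth_on (N e k) (fs e s (Suc k))"
proof -
  have step: "smooth_on (N e k) (fs_coeff e s k) \<and> smooth_on (N e k) (fs e s (Suc k))"
    if op: "open (N e k)" and sm: "smooth_on (N e k) (fs e s k)" for k
  proof
    show co: "smooth_on (N e k) (fs_coeff e s k)"
      unfolding fs_coeff_def[abs_def]
      by (intro smooth_on_mult smooth_on_inverse smooth_on_herm smooth_on_wd op sm)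
        (simp add: N_def)
    have "smooth_on (N e k) (\<lambda>z. wd e (fs e s k) z - fs_coeff e s k z *s fs e s k z)"
      by (intro smooth_on_diff smooth_on_wd smooth_on_scale op sm co)
    then show "smooth_on (N e k) (fs e s (Suc k))"
      using smooth_on_cong[OF op, of "fs e s (Suc k)"
          "\<lambda>z. wd e (fs e s k) z - fs_coeff e s k z *s fs e s k z"]
      by (simp add: N_def fs_Suc_eq del: fs.simps)
  qed
  show ?thesis
  proof (induction k)
    case 0
    have "open (N e 0)" "smooth_on (N e 0) (fs e s 0)"
      unfolding N_0 using open_M smooth_s by simp_all
    then show ?case
      using step by blast
  next
    case (Suc k)
    have "N e (Suc k) = {z \<in> N e k. fs e s (Suc k) z \<noteq> 0}"
      using N_Suc_subset by (auto simp: N_def)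
    also have "\<dots> = N e k \<inter> fs e s (Suc k) -` (- {0})"
      by auto
    also have "open \<dots>"
      using Suc.IH by (intro continuous_open_preimage smooth_on_continuous_on) auto
    finally have "open (N e (Suc k))" .
    moreover have "smooth_on (N e (Suc k)) (fs e s (Suc k))"
      using smooth_on_subset[OF _ N_Suc_subset] Suc.IH by blast
    ultimately show ?case
      using step by blast
  qed
qed

lemma open_N: "open (N e k)"
  and smooth_fs: "smooth_on (N e k) (fs e s k)"
  and smooth_fs_coeff: "smooth_on (N e k) (fs_coeff e s k)"
  and smooth_fs_Suc: "smooth_on (N e k) (fs e s (Suc k))"
  using open_N_smooth by blast+

lemma differentiable_fs: "z \<in> N e k \<Longrightarrow> fs e s k differentiable at z"
  by (rule smooth_on_differentiable[OF open_N smooth_fs])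

lemma fs_1: "z \<in> M \<Longrightarrow> fs e s (Suc 0) z = wd e s z"
  using s_nonzero horizontal by simp

text \<open>Apply the opposite derivative to the recursion for \<open>f_{k+2}\<close> and commute:
  the result lies in the span of \<open>f_k\<close> and \<open>f_{k+1}\<close>. Orthogonality of
  \<open>f_{k+2}\<close> to \<open>f_k\<close> then removes the component along
  \<open>f_k\<close>.\<close>

lemma wd_fs_back_step:
  assumes lower: "\<And>z. z \<in> N e k \<Longrightarrow> \<exists>c. wd (- e) (fs e s (Suc k)) z = c *s fs e s k z"
    and orth: "\<And>z. z \<in> N e (Suc k) \<Longrightarrow> herm (fs e s (Suc (Suc k)) z) (fs e s k z) = 0"
    and z: "z \<in> N e (Suc k)"
  shows "\<exists>c. wd (- e) (fs e s (Suc (Suc k))) z = c *s fs e s (Suc k) z"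
proof -
  note [simp del] = fs.simps
  define F0 F1 F2 where "F0 = fs e s k" and "F1 = fs e s (Suc k)" and "F2 = fs e s (Suc (Suc k))"
  define a where "a = fs_coeff e s (Suc k)"
  \<comment> \<open>The factor in \<open>lower\<close> is only given pointwise; as this quotient it
    is smooth and can be differentiated.\<close>
  define \<gamma> where "\<gamma> = (\<lambda>w. herm (wd (- e) F1 w) (F0 w) * inverse (herm (F0 w) (F0 w)))"
  let ?U = "N e k" and ?V = "N e (Suc k)"
  have zU: "z \<in> ?U"
    using z N_Suc_subset by blast
  have sm: "smooth_on ?U F0" "smooth_on ?U F1" "smooth_on ?V F1" "smooth_on ?V F2" "smooth_on ?V a"
    unfolding F0_def F1_def F2_def a_def
    using smooth_fs smooth_fs_Suc smooth_fs_coeff by blast+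
  have sm\<gamma>: "smooth_on ?U \<gamma>"
    unfolding \<gamma>_def
    by (intro smooth_on_mult smooth_on_inverse smooth_on_herm smooth_on_wd open_N sm)
      (simp add: N_def F0_def)
  have F0: "F0 z \<noteq> 0"
    using zU by (simp add: N_def F0_def)
  have lower': "wd (- e) F1 w = \<gamma> w *s F0 w" if w: "w \<in> ?U" for w
  proof -
    obtain c where "wd (- e) F1 w = c *s F0 w"
      using lower[OF w] unfolding F0_def F1_def by blast
    moreover from this have "c = \<gamma> w"
      using w by (simp add: \<gamma>_def herm_scale_left N_def F0_def)
    ultimately show ?thesis
      by simp
  qed
  have F2: "F2 w = wd e F1 w - a w *s F1 w" if "w \<in> ?V" for w
    using that fs_Suc_eq[of e s "Suc k" w] by (simp add: F1_def F2_def a_def N_def)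
  have wdF0: "wd e F0 z = F1 z + fs_coeff e s k z *s F0 z"
    using wd_fs_eq[of e s k z] F0 by (simp add: F0_def F1_def)
  note d = smooth_on_differentiable[OF open_N _ z] smooth_on_differentiable[OF open_N _ zU]
  have "wd (- e) (wd e F1) z = wd e (wd (- e) F1) z"
    by (rule wd_commute[OF open_N sm(2) zU])
  also have "\<dots> = wd e (\<lambda>w. \<gamma> w *s F0 w) z"
    by (rule wd_cong[OF open_N zU lower'])
  also have "\<dots> = cd e \<gamma> z *s F0 z + \<gamma> z *s wd e F0 z"
    by (rule wd_scale[OF d(2)[OF sm\<gamma>] d(2)[OF sm(1)]])
  finally have comm: "wd (- e) (wd e F1) z = cd e \<gamma> z *s F0 z + \<gamma> z *s wd e F0 z" .
  have "wd (- e) F2 z = wd (- e) (\<lambda>w. wd e F1 w - a w *s F1 w) z"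
    by (rule wd_cong[OF open_N z F2])
  also have "\<dots> = wd (- e) (wd e F1) z - wd (- e) (\<lambda>w. a w *s F1 w) z"
    by (intro wd_diff d(1) smooth_on_wd smooth_on_scale open_N sm)
  also have "wd (- e) (\<lambda>w. a w *s F1 w) z = cd (- e) a z *s F1 z + a z *s (\<gamma> z *s F0 z)"
    unfolding wd_scale[OF d(1)[OF sm(5)] d(1)[OF sm(3)]] lower'[OF zU] ..
  also have "wd (- e) (wd e F1) z - (cd (- e) a z *s F1 z + a z *s (\<gamma> z *s F0 z))
      = (cd e \<gamma> z + \<gamma> z * fs_coeff e s k z - a z * \<gamma> z) *s F0 z + (\<gamma> z - cd (- e) a z) *s F1 z"
    unfolding comm wdF0 by (simp add: vec_eq_iff algebra_simps)
  finally obtain \<alpha> \<beta> where \<alpha>\<beta>: "wd (- e) F2 z = \<alpha> *s F0 z + \<beta> *s F1 z"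
    by blast
  have F10: "herm (F1 z) (F0 z) = 0"
    unfolding F0_def F1_def by (rule fs_orthogonal)
  have F20: "herm (F2 z) (F0 z) = 0"
    unfolding F0_def F2_def by (rule orth[OF z])
  have F21: "herm (F2 z) (F1 z) = 0"
    unfolding F1_def F2_def by (rule fs_orthogonal)
  \<comment> \<open>The derivative of \<open>F2 \<bottom> F0\<close>: its second term vanishes
    because \<open>wd e F0\<close> lies in the span of \<open>F1\<close> and \<open>F0\<close>, both
    orthogonal to \<open>F2\<close>.\<close>
  have "herm (wd (- e) F2 z) (F0 z) + herm (F2 z) (wd (- (- e)) F0 z) = 0"
    by (rule wd_herm_zero[OF open_N z _ d(1)[OF sm(4)] d(2)[OF sm(1)]])
      (simp add: F0_def F2_def orth)
  then have "\<alpha> * herm (F0 z) (F0 z) = 0"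
    by (simp add: \<alpha>\<beta> wdF0 herm_simps F10 F20 F21)
  then have "\<alpha> = 0"
    using F0 by simp
  then show ?thesis
    using \<alpha>\<beta> by (auto simp: F1_def F2_def)
qed

text \<open>The two statements are proved in one induction. Differentiating
  \<open>f_{k+1} \<bottom> f_k\<close> reduces orthogonality to the opposite derivative of
  \<open>f_k\<close>, which is a multiple of \<open>f_{k-1}\<close>; for \<open>k = 0\<close>
  conformality takes its place. The opposite derivative in turn advances by
  \<open>wd_fs_back_step\<close>.\<close>

lemma wd_fs_back_and_orthogonal:
  assumes e: "e * e = 1"
  shows "(\<forall>z\<in>N e k. \<exists>c. wd (- e) (fs e s (Suc k)) z = c *s fs e s k z) \<and>
    (\<forall>z\<in>N e (Suc k). herm (fs e s (Suc (Suc k)) z) (fs e s k z) = 0)"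
proof -
  note [simp del] = fs.simps(2)
  have orth: "herm (fs e s (Suc (Suc k)) z) (fs e s k z) = 0"
    if z: "z \<in> N e (Suc k)" and "herm (fs e s (Suc k) z) (wd (- e) (fs e s k) z) = 0" for k z
  proof -
    have zk: "z \<in> N e k"
      using z N_Suc_subset by blast
    have "herm (wd e (fs e s (Suc k)) z) (fs e s k z)
        + herm (fs e s (Suc k) z) (wd (- e) (fs e s k) z) = 0"
      by (rule wd_herm_zero[OF open_N z fs_orthogonal differentiable_fs[OF z] differentiable_fs[OF zk]])
    then show ?thesis
      using that fs_Suc_eq[of e s "Suc k" z] fs_orthogonal[of e s k z]
      by (simp add: N_def herm_simps)
  qed
  show ?thesis
  proof (induction k)
    case 0
    have "\<exists>c. wd (- e) (fs e s (Suc 0)) z = c *s s z" if "z \<in> M" for z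
    proof -
      have "wd (- e) (fs e s (Suc 0)) z = wd (- e) (wd e s) z"
        by (rule wd_cong[OF open_M that fs_1])
      then show ?thesis
        using harmonic[OF e that] by simp
    qed
    moreover have "herm (fs e s (Suc (Suc 0)) z) (s z) = 0" if z: "z \<in> N e (Suc 0)" for z
    proof -
      have "z \<in> M"
        using z by (simp add: N_def)
      then show ?thesis
        using orth[OF z] conformal[OF e, of z] by (simp add: fs_1)
    qed
    ultimately show ?case
      by (simp add: N_0)
  next
    case (Suc k)
    have "herm (fs e s (Suc (Suc (Suc k))) z) (fs e s (Suc k) z) = 0"
      if z: "z \<in> N e (Suc (Suc k))" for z
    proof -
      have z1: "z \<in> N e (Suc k)" and "z \<in> N e k"
        using z N_Suc_subset by blast+
      then obtain c where "wd (- e) (fs e s (Suc k)) z = c *s fs e s k z"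
        using Suc.IH by blast
      then show ?thesis
        using orth[OF z] Suc.IH z1 by (simp add: herm_scale_right)
    qed
    moreover have "\<exists>c. wd (- e) (fs e s (Suc (Suc k))) z = c *s fs e s (Suc k) z"
      if "z \<in> N e (Suc k)" for z
      using wd_fs_back_step[OF _ _ that] Suc.IH by blast
    ultimately show ?case
      by blast
  qed
qed

lemma wd_fs_back:
  "e * e = 1 \<Longrightarrow> z \<in> N e k \<Longrightarrow> \<exists>c. wd (- e) (fs e s (Suc k)) z = c *s fs e s k z"
  using wd_fs_back_and_orthogonal by blast

section \<open>The relations between the two halves of the sequence with respect to \<omega>\<close>

lemma deriv_symplectic_zero:
  assumes zero: "\<And>w. w \<in> M \<Longrightarrow> herm (fs a s k w) (jmul (fs b s l w)) = 0"
    and z: "z \<in> N a k" "z \<in> N b l"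
  shows "herm (wd e (fs a s k) z) (jmul (fs b s l z)) + herm (fs a s k z) (jmul (wd e (fs b s l) z)) = 0"
  using z by (intro wd_herm_jmul_zero[OF open_M _ zero] differentiable_fs) (auto simp: N_def)

text \<open>Raises the first index by one: differentiating the relation moves the derivative to the
  second argument, where \<open>other\<close> disposes of it. At a zero of either section the claim
  holds by the default value 0.\<close>

lemma symplectic_next:
  assumes zero: "\<And>w. w \<in> M \<Longrightarrow> herm (fs e s k w) (jmul (fs b s l w)) = 0"
    and other: "z \<in> N e k \<Longrightarrow> z \<in> N b l \<Longrightarrow> herm (fs e s k z) (jmul (wd e (fs b s l) z)) = 0"
    and z: "z \<in> M"
  shows "herm (fs e s (Suc k) z) (jmul (fs b s l z)) = 0"
proof (cases "fs e s k z = 0 \<or> fs b s l z = 0")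
  case False
  then have zN: "z \<in> N e k" "z \<in> N b l"
    using z by (auto simp: N_def)
  show ?thesis
    using deriv_symplectic_zero[OF zero zN, of e] other[OF zN] zero[OF z] fs_Suc_eq[of e s k z] False
    by (simp add: herm_simps del: fs.simps)
qed auto

lemma symplectic_0:
  assumes "z \<in> M"
  shows "herm (fs e s (Suc 0) z) (jmul (s z)) = 0"
    and "herm (fs e s (Suc (Suc 0)) z) (jmul (s z)) = 0"
proof -
  have 1: "herm (fs e s (Suc 0) z) (jmul (s z)) = 0" if "z \<in> M" for z
    using horizontal_j[OF that] fs_1[OF that] by simp
  show "herm (fs e s (Suc 0) z) (jmul (s z)) = 0"
    by (rule 1[OF assms])
  \<comment> \<open>Here both derivatives go in the same direction, so the term left over is
    \<omega> of the first section with itself.\<close>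
  show "herm (fs e s (Suc (Suc 0)) z) (jmul (s z)) = 0"
    using symplectic_next[of e "Suc 0" e 0, OF _ _ assms] 1 assms fs_1[OF assms]
    by (simp del: fs.simps(2))
qed

text \<open>The three relations form one induction over both signs. At level \<open>k + 1\<close>
  the first starts from the second of level \<open>k\<close> with the sign reversed, and each of the
  other two raises the first index of its predecessor. The leftover terms are exactly the three
  relations of level \<open>k\<close>.\<close>

lemma symplectic:
  assumes "e * e = 1" "z \<in> M"
  shows "herm (fs e s k z) (jmul (fs (- e) s k z)) = 0"
    and "herm (fs e s (Suc k) z) (jmul (fs (- e) s k z)) = 0"
    and "herm (fs e s (Suc (Suc k)) z) (jmul (fs (- e) s k z)) = 0"
proof -
  note [simp del] = fs.simps(2)
  have "\<forall>e z. e * e = 1 \<longrightarrow> z \<in> M \<longrightarrow> herm (fs e s k z) (jmul (fs (- e) s k z)) = 0 \<and>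
    herm (fs e s (Suc k) z) (jmul (fs (- e) s k z)) = 0 \<and>
    herm (fs e s (Suc (Suc k)) z) (jmul (fs (- e) s k z)) = 0"
  proof (induction k)
    case 0
    then show ?case
      by (simp add: symplectic_0)
  next
    case (Suc k)
    \<comment> \<open>For the sequence with sign \<open>- e\<close> the operator \<open>wd e\<close>
      is the opposite derivative, so it lowers the second index back to \<open>k\<close>.\<close>
    have lower: "\<exists>c. wd e (fs (- e) s (Suc k)) z = c *s fs (- e) s k z"
      if "e * e = 1" "z \<in> N (- e) (Suc k)" for e z
      using wd_fs_back[of "- e" z k] that N_Suc_subset by auto
    have 1: "herm (fs e s (Suc k) z) (jmul (fs (- e) s (Suc k) z)) = 0"
      if e: "e * e = 1" and z: "z \<in> M" for e z
    proof (rule symplectic_next[OF _ _ z])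
      \<comment> \<open>The second relation for \<open>- e\<close>, with its arguments exchanged by
        skew-symmetry.\<close>
      show "herm (fs e s k w) (jmul (fs (- e) s (Suc k) w)) = 0" if w: "w \<in> M" for w
        using Suc.IH[rule_format, of "- e" w] e w
          herm_jmul_right[of "fs e s k w" "fs (- e) s (Suc k) w"] by simp
      show "herm (fs e s k z) (jmul (wd e (fs (- e) s (Suc k)) z)) = 0"
        if "z \<in> N (- e) (Suc k)"
        using lower[OF e that] Suc.IH[rule_format, OF e z]
        by (auto simp: jmul_scale herm_scale_right)
    qed
    have 2: "herm (fs e s (Suc (Suc k)) z) (jmul (fs (- e) s (Suc k) z)) = 0"
      if e: "e * e = 1" and z: "z \<in> M" for e z
    proof (rule symplectic_next[OF 1[OF e] _ z])
      show "herm (fs e s (Suc k) z) (jmul (wd e (fs (- e) s (Suc k)) z)) = 0"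
        if "z \<in> N (- e) (Suc k)"
        using lower[OF e that] Suc.IH[rule_format, OF e z]
        by (auto simp: jmul_scale herm_scale_right)
    qed
    have 3: "herm (fs e s (Suc (Suc (Suc k))) z) (jmul (fs (- e) s (Suc k) z)) = 0"
      if e: "e * e = 1" and z: "z \<in> M" for e z
    proof (rule symplectic_next[OF 2[OF e] _ z])
      show "herm (fs e s (Suc (Suc k)) z) (jmul (wd e (fs (- e) s (Suc k)) z)) = 0"
        if "z \<in> N (- e) (Suc k)"
        using lower[OF e that] Suc.IH[rule_format, OF e z]
        by (auto simp: jmul_scale herm_scale_right)
    qed
    show ?case
      using 1 2 3 by blast
  qed
  then show "herm (fs e s k z) (jmul (fs (- e) s k z)) = 0"
    and "herm (fs e s (Suc k) z) (jmul (fs (- e) s k z)) = 0"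
    and "herm (fs e s (Suc (Suc k)) z) (jmul (fs (- e) s k z)) = 0"
    using assms by blast+
qed

end

section \<open>Horizontal minimal lifts\<close>

lemma subspace_cp: "vec.subspace (cp q)"
  by (simp add: cp_def)

lemma jmul_cp: "jmul ` cp q = cp (jmul q)"
proof (intro subset_antisym subsetI)
  fix x assume "x \<in> jmul ` cp q"
  then obtain c where "x = jmul (c *s q)"
    unfolding cp_eq by blast
  then show "x \<in> cp (jmul q)"
    unfolding cp_eq jmul_scale by blast
next
  fix x assume "x \<in> cp (jmul q)"
  then obtain c where "x = jmul (cnj c *s q)"
    unfolding cp_eq by (auto simp: jmul_scale)
  then show "x \<in> jmul ` cp q"
    unfolding cp_eq by blast
qed

lemma herm_cp_zero: "herm v q = 0 \<Longrightarrow> w \<in> cp q \<Longrightarrow> herm v w = 0"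
  by (auto simp: cp_eq herm_scale_right)

lemma perp_zero: "vec.subspace W \<Longrightarrow> perp W 0 = 0"
  by (rule perp_eqI) (simp_all add: vec.subspace_0)

lemma dd_cong:
  assumes "open U" "z \<in> U" "\<And>w. w \<in> U \<Longrightarrow> v w = u w"
  shows "dd v X z = dd u X z"
  using frechet_derivative_cong_open[OF assms(1,2), of v u] assms(3) by (simp add: dd_def)

text \<open>Horizontality identifies the differential of \<open>[s]\<close> with \<open>ds\<close>.
  Vanishing tension then says that the Laplacian of \<open>s\<close> is a multiple of
  \<open>s\<close>, and \<open>wd_wd\<close> turns this into the locale's
  \<open>harmonic\<close>.\<close>

lemma horizontal_harmonic_lift_of_minimal:
  assumes op: "open M" and lift: "totally_real_horizontal_minimal_lift M g \<phi> s"
  shows "horizontal_harmonic_lift M s"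
proof
  note L = lift[unfolded totally_real_horizontal_minimal_lift_def hp_lift_def
      cp_minimal_immersion_def]
  show sm: "smooth_on M s"
    using L by blast
  have norm: "norm (s z) = 1" if "z \<in> M" for z
    using L that by blast
  have hor: "herm (dd s X z) (s z) = 0" "herm (dd s X z) (jmul (s z)) = 0" if "z \<in> M" for z X
    using L that by blast+
  have diff: "differential (\<lambda>w. cp (s w)) X s z = dd s X z" if "z \<in> M" for z X
    unfolding differential_def
    by (rule perp_eqI[OF subspace_cp])
      (simp_all add: herm_cp_zero[OF hor(1)[OF that]] subspace_cp vec.subspace_0)
  fix z assume z: "z \<in> M"
  show "s z \<noteq> 0"
    using norm[OF z] by auto
  show "herm (wd e s z) (s z) = 0" "herm (wd e s z) (jmul (s z)) = 0" for e
    using hor[OF z] by (simp_all add: wd_def herm_simps)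
  fix e :: real assume e: "e * e = 1"
  show "herm (wd e s z) (wd (- e) s z) = 0"
  proof -
    have iso: "dd s X z \<bullet> dd s Y z = g z * (X \<bullet> Y)" for X Y
      using L z unfolding cp_isometric_def by (simp add: diff)
    have self: "herm (dd s X z) (dd s X z) = of_real (g z * (X \<bullet> X))" for X
      by (simp add: herm_self power2_norm_eq_inner iso)
    \<comment> \<open>By isometry this product has real part 0, so the cross terms cancel; the
      remaining terms cancel because both partial derivatives have the same length.\<close>
    have "herm (dd s \<i> z) (dd s 1 z) = - herm (dd s 1 z) (dd s \<i> z)"
      using cnj_herm[of "dd s 1 z" "dd s \<i> z"] Re_herm[of "dd s 1 z" "dd s \<i> z"]
      by (auto simp: complex_eq_iff iso inner_complex_def)
    moreover have "complex_of_real e * complex_of_real e = 1"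
      using e by (metis of_real_1 of_real_mult)
    ultimately show ?thesis
      by (simp add: wd_def herm_simps self inner_complex_def algebra_simps)
  qed
  show "\<exists>c. wd (- e) (wd e s) z = c *s s z"
  proof -
    \<comment> \<open>The connection term of the Hessian differentiates the projection of
      \<open>ds\<close> to the line, which is identically 0.\<close>
    have "hessian (\<lambda>w. cp (s w)) X s z = perp (cp (s z)) (dd (dd s X) X z)" for X
    proof -
      have "dd (differential (\<lambda>w. cp (s w)) X s) X z = dd (dd s X) X z"
        by (rule dd_cong[OF op z diff])
      moreover have "proj (cp (s w)) (dd s X w) = 0" if "w \<in> M" for w
        by (rule proj_eqI[OF subspace_cp])
          (simp_all add: herm_cp_zero[OF hor(1)[OF that]] subspace_cp vec.subspace_0)
      then have "dd (\<lambda>w. proj (cp (s w)) (dd s X w)) X z = dd (\<lambda>w. 0) X z"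
        by (rule dd_cong[OF op z])
      then have "differential (\<lambda>w. cp (s w)) X (\<lambda>w. proj (cp (s w)) (dd s X w)) z = 0"
        unfolding differential_def
        by (simp add: dd_def frechet_derivative_const perp_zero subspace_cp)
      ultimately show ?thesis
        by (simp add: hessian_def)
    qed
    moreover have "perp (cp (s z)) v = v - herm v (s z) *s s z" for v
      using norm[OF z]
      by (intro perp_eqI[OF subspace_cp _ herm_cp_zero]) (auto simp: cp_eq herm_simps herm_self)
    moreover have "tension (\<lambda>w. cp (s w)) s z = 0"
      using L z by blast
    ultimately have "(dd (dd s 1) 1 z - herm (dd (dd s 1) 1 z) (s z) *s s z)
        + (dd (dd s \<i>) \<i> z - herm (dd (dd s \<i>) \<i> z) (s z) *s s z) = 0"
      by (simp only: tension_def)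
    then have "dd (dd s 1) 1 z + dd (dd s \<i>) \<i> z
        = (herm (dd (dd s 1) 1 z) (s z) + herm (dd (dd s \<i>) \<i> z) (s z)) *s s z"
      by (simp add: vec_eq_iff algebra_simps)
    moreover have "wd (- e) (wd e s) z = (1/4) *s (dd (dd s 1) 1 z + dd (dd s \<i>) \<i> z)"
      using e by (simp add: wd_wd[OF op sm z])
    ultimately show ?thesis
      by (metis vector_smult_assoc)
  qed
qed (rule op)


section \<open>Bundles spanned by the sections\<close>

definition A_wd ::
    "real \<Rightarrow> (complex \<Rightarrow> 'm::finite cvec set) \<Rightarrow> (complex \<Rightarrow> 'm cvec) \<Rightarrow> complex \<Rightarrow> 'm cvec" where
  "A_wd e \<psi> v z = perp (\<psi> z) (wd e v z)"

lemma A'_eq: "A' = A_wd 1"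
  by (simp add: fun_eq_iff A'_def A_wd_def dz_eq_wd)

lemma A''_eq: "A'' = A_wd (- 1)"
  by (simp add: fun_eq_iff A''_def A_wd_def dzbar_eq_wd)

lemma subbundle_line_frame:
  assumes "subbundle M 1 \<psi>" "z \<in> M"
  obtains U E where "open U" "z \<in> U" "U \<subseteq> M" "smooth_on U E"
    "\<And>w. w \<in> U \<Longrightarrow> E w \<noteq> 0 \<and> \<psi> w = cp (E w)"
proof -
  obtain U e where U: "open U" "z \<in> U" "U \<subseteq> M" "\<forall>i<1. smooth_on U (e i)"
    and e: "\<forall>w\<in>U. inj_on (\<lambda>i::nat. e i w) {..<1} \<and> \<not> vec.dependent ((\<lambda>i. e i w) ` {..<1}) \<and>
               \<psi> w = vec.span ((\<lambda>i. e i w) ` {..<1})"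
    using bspec[OF assms(1)[unfolded subbundle_def] assms(2)] by (elim exE conjE)
  show thesis
  proof (rule that[of U "e 0"])
    show "smooth_on U (e 0)"
      using U(4) by simp
    fix w assume w: "w \<in> U"
    have im: "(\<lambda>i. e i w) ` {..<1} = {e 0 w}"
      by auto
    show "e 0 w \<noteq> 0 \<and> \<psi> w = cp (e 0 w)"
      using e[rule_format, OF w] unfolding im cp_def by (auto simp: vec.dependent_zero)
  qed (rule U)+
qed

lemma subbundle_plane_frame:
  assumes "subbundle M 2 \<psi>" "z \<in> M"
  obtains U p q where "open U" "z \<in> U" "U \<subseteq> M" "smooth_on U p" "smooth_on U q"
    "\<And>w. w \<in> U \<Longrightarrow> p w \<noteq> q w \<and> vec.independent {p w, q w} \<and> \<psi> w = vec.span {p w, q w}"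
proof -
  obtain U e where U: "open U" "z \<in> U" "U \<subseteq> M" "\<forall>i<2. smooth_on U (e i)"
    and e: "\<forall>w\<in>U. inj_on (\<lambda>i::nat. e i w) {..<2} \<and> \<not> vec.dependent ((\<lambda>i. e i w) ` {..<2}) \<and>
               \<psi> w = vec.span ((\<lambda>i. e i w) ` {..<2})"
    using bspec[OF assms(1)[unfolded subbundle_def] assms(2)] by (elim exE conjE)
  show thesis
  proof (rule that[of U "e 0" "e 1"])
    show "smooth_on U (e 0)" "smooth_on U (e 1)"
      using U(4) by simp_all
    fix w assume w: "w \<in> U"
    have "{..<2} = {0, 1::nat}"
      by auto
    then have im: "(\<lambda>i. e i w) ` {..<2} = {e 0 w, e 1 w}"
      by simp
    note ew = bspec[OF e w]
    have "e 0 w \<noteq> e 1 w"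
      using inj_onD[OF conjunct1[OF ew], of 0 1] by auto
    then show "e 0 w \<noteq> e 1 w \<and> vec.independent {e 0 w, e 1 w} \<and> \<psi> w = vec.span {e 0 w, e 1 w}"
      using conjunct2[OF ew, unfolded im] by (rule conjI)
  qed (rule U)+
qed

text \<open>\<open>image_at\<close> differentiates sections, so knowing a bundle at one point is not
  enough. The exceptional set is closed in \<open>M\<close>, hence a property valid off it is valid
  on neighbourhoods.\<close>

lemma eventually_cosparse_nhd:
  assumes "open M" "eventually P (cosparse M)"
  shows "eventually (\<lambda>z. \<exists>U. open U \<and> z \<in> U \<and> U \<subseteq> M \<and> (\<forall>w\<in>U. P w)) (cosparse M)"
proof -
  have "open (M - {z. \<not> P z})"
    using assms by (intro open_diff_sparse_pts) (simp_all add: eventually_cosparse)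
  moreover have "eventually (\<lambda>z. z \<in> M) (cosparse M)"
    using assms(1) by (simp add: eventually_cosparse_open_eq eventually_at_in_open')
  with assms(2) have "eventually (\<lambda>z. z \<in> M - {z. \<not> P z}) (cosparse M)"
    by eventually_elim auto
  ultimately show ?thesis
    by (auto elim!: eventually_mono)
qed

section \<open>Images of the second fundamental forms in explicit frames\<close>

text \<open>\<open>A_wd\<close> is linear over functions: for a section \<open>l *s a\<close> the
  Leibniz term lies in the line itself and is projected away, leaving
  \<open>l z *s a1\<close>.\<close>

lemma image_at_line:
  assumes op: "open U" "z \<in> U" "U \<subseteq> M" and sm: "smooth_on U a"
    and \<psi>: "\<And>w. w \<in> U \<Longrightarrow> a w \<noteq> 0 \<and> \<psi> w = cp (a w)"
    and D: "wd e a z = a1 + \<alpha> *s a z" and orth: "herm a1 (a z) = 0"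
  shows "image_at M (A_wd e) \<psi> z = cp a1"
proof -
  have A: "A_wd e \<psi> v z = l z *s a1"
    if V: "open V" "z \<in> V" "V \<subseteq> U" and l: "smooth_on V l" "\<And>w. w \<in> V \<Longrightarrow> v w = l w *s a w" for v l V
  proof -
    have "wd e v z = wd e (\<lambda>w. l w *s a w) z"
      by (rule wd_cong[OF V(1,2) l(2)])
    also have "\<dots> = cd e l z *s a z + l z *s (a1 + \<alpha> *s a z)"
      unfolding D[symmetric]
      by (intro wd_scale smooth_on_differentiable[OF V(1) l(1) V(2)]
          smooth_on_differentiable[OF op(1) sm op(2)])
    finally have eq: "wd e v z - l z *s a1 = (cd e l z + l z * \<alpha>) *s a z"
      by (simp add: vec_eq_iff algebra_simps)
    have "wd e v z - l z *s a1 \<in> cp (a z)"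
      unfolding eq cp_eq by (rule rangeI)
    moreover have "herm (l z *s a1) (a z) = 0"
      using orth by (simp add: herm_scale_left)
    ultimately have "perp (cp (a z)) (wd e v z) = l z *s a1"
      by (intro perp_eqI[OF subspace_cp _ herm_cp_zero])
    then show ?thesis
      using \<psi>[OF op(2)] by (simp add: A_wd_def)
  qed
  show ?thesis
  proof (intro subset_antisym subsetI)
    fix x assume "x \<in> image_at M (A_wd e) \<psi> z"
    then obtain v V where x: "x = A_wd e \<psi> v z" and V: "open V" "z \<in> V" "smooth_section V \<psi> v"
      unfolding image_at_def by blast
    \<comment> \<open>The coordinate of \<open>v\<close> in the frame, as a quotient that is visibly
      smooth.\<close>
    define l where "l = (\<lambda>w. herm (v w) (a w) * inverse (herm (a w) (a w)))"
    have UV: "open (V \<inter> U)"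
      using V(1) op(1) by (rule open_Int)
    have "smooth_on (V \<inter> U) l"
      unfolding l_def using V(3) \<psi>
      by (intro smooth_on_mult smooth_on_inverse smooth_on_herm UV)
        (auto simp: smooth_section_def intro: smooth_on_subset[OF sm] smooth_on_subset[of V v])
    moreover have "v w = l w *s a w" if "w \<in> V \<inter> U" for w
    proof -
      have "v w \<in> cp (a w)"
        using V(3) \<psi>[of w] that by (auto simp: smooth_section_def)
      then obtain c where "v w = c *s a w"
        unfolding cp_eq by blast
      then show ?thesis
        using \<psi>[of w] that by (simp add: l_def herm_scale_left mult.assoc)
    qed
    ultimately have "x = l z *s a1"
      unfolding x using V(2) op(2) UV by (intro A[of "V \<inter> U"]) auto
    then show "x \<in> cp a1"
      by (auto simp: cp_eq)
  next
    fix x assume "x \<in> cp a1"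
    then obtain c where x: "x = c *s a1"
      by (auto simp: cp_eq)
    have "smooth_on U (\<lambda>w. c *s a w)"
      by (intro smooth_on_scale smooth_on_const op sm)
    then have "smooth_section U \<psi> (\<lambda>w. c *s a w)"
      using \<psi> by (auto simp: smooth_section_def cp_eq)
    moreover have "A_wd e \<psi> (\<lambda>w. c *s a w) z = x"
      unfolding x using op by (intro A[of U "\<lambda>w. c"] smooth_on_const) auto
    ultimately show "x \<in> image_at M (A_wd e) \<psi> z"
      unfolding image_at_def using op by blast
  qed
qed

text \<open>The same computation in an orthogonal frame. Since \<open>a1\<close> and
  \<open>b1\<close> are orthogonal to the whole plane, they are the images of \<open>a\<close> and
  \<open>b\<close>; they may be dependent or zero.\<close>

lemma image_at_plane:
  assumes op: "open U" "z \<in> U" "U \<subseteq> M" and sm: "smooth_on U a" "smooth_on U b"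
    and \<psi>: "\<And>w. w \<in> U \<Longrightarrow> a w \<noteq> 0 \<and> b w \<noteq> 0 \<and> herm (a w) (b w) = 0 \<and> \<psi> w = vec.span {a w, b w}"
    and D: "wd e a z = a1 + \<alpha> *s a z" "wd e b z = b1 + \<beta> *s b z"
    and orth: "herm a1 (a z) = 0" "herm a1 (b z) = 0" "herm b1 (a z) = 0" "herm b1 (b z) = 0"
  shows "image_at M (A_wd e) \<psi> z = vec.span {a1, b1}"
proof -
  have A: "A_wd e \<psi> v z = l z *s a1 + m z *s b1"
    if V: "open V" "z \<in> V" "V \<subseteq> U" and l: "smooth_on V l" "smooth_on V m"
      and v: "\<And>w. w \<in> V \<Longrightarrow> v w = l w *s a w + m w *s b w" for v l m V
  proof -
    note d = smooth_on_differentiable[OF V(1) _ V(2)]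
    note sm' = smooth_on_subset[OF sm(1) V(3)] smooth_on_subset[OF sm(2) V(3)]
    have "wd e v z = wd e (\<lambda>w. l w *s a w + m w *s b w) z"
      by (rule wd_cong[OF V(1,2) v])
    also have "\<dots> = wd e (\<lambda>w. l w *s a w) z + wd e (\<lambda>w. m w *s b w) z"
      by (intro wd_add d smooth_on_scale V l sm')
    also have "wd e (\<lambda>w. l w *s a w) z = cd e l z *s a z + l z *s (a1 + \<alpha> *s a z)"
      unfolding D[symmetric] by (intro wd_scale d l sm')
    also have "wd e (\<lambda>w. m w *s b w) z = cd e m z *s b z + m z *s (b1 + \<beta> *s b z)"
      unfolding D[symmetric] by (intro wd_scale d l sm')
    finally have "wd e v z - (l z *s a1 + m z *s b1)
        = (cd e l z + l z * \<alpha>) *s a z + (cd e m z + m z * \<beta>) *s b z"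
      by (simp add: vec_eq_iff algebra_simps)
    then have mem: "wd e v z - (l z *s a1 + m z *s b1) \<in> \<psi> z"
      using \<psi>[OF op(2)] unfolding span_pair by blast
    have sub: "vec.subspace (\<psi> z)"
      using \<psi>[OF op(2)] by simp
    have "herm (l z *s a1 + m z *s b1) w = 0" if "w \<in> \<psi> z" for w
      using that \<psi>[OF op(2)] orth by (auto simp: span_pair herm_simps)
    then show ?thesis
      unfolding A_wd_def by (rule perp_eqI[OF sub mem])
  qed
  show ?thesis
  proof (intro subset_antisym subsetI)
    fix x assume "x \<in> image_at M (A_wd e) \<psi> z"
    then obtain v V where x: "x = A_wd e \<psi> v z" and V: "open V" "z \<in> V" "smooth_section V \<psi> v"
      unfolding image_at_def by blast
    define l where "l = (\<lambda>w. herm (v w) (a w) * inverse (herm (a w) (a w)))"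
    define m where "m = (\<lambda>w. herm (v w) (b w) * inverse (herm (b w) (b w)))"
    have UV: "open (V \<inter> U)"
      using V(1) op(1) by (rule open_Int)
    have "smooth_on (V \<inter> U) l" "smooth_on (V \<inter> U) m"
      unfolding l_def m_def using V(3) \<psi>
      by (intro smooth_on_mult smooth_on_inverse smooth_on_herm UV;
          auto simp: smooth_section_def intro: smooth_on_subset[OF sm(1)] smooth_on_subset[OF sm(2)]
            smooth_on_subset[of V v])+
    moreover have "v w = l w *s a w + m w *s b w" if "w \<in> V \<inter> U" for w
    proof -
      have "v w \<in> vec.span {a w, b w}"
        using V(3) \<psi>[of w] that by (auto simp: smooth_section_def)
      then obtain c d where "v w = c *s a w + d *s b w"
        unfolding span_pair by blast
      moreover have "herm (a w) (b w) = 0" "herm (b w) (a w) = 0" "a w \<noteq> 0" "b w \<noteq> 0"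
        using \<psi>[of w] that by (auto simp: herm_eq_0_sym[of "b w"])
      ultimately show ?thesis
        by (simp add: l_def m_def herm_simps mult.assoc)
    qed
    ultimately have "x = l z *s a1 + m z *s b1"
      unfolding x using V(2) op(2) UV by (intro A[of "V \<inter> U"]) auto
    then show "x \<in> vec.span {a1, b1}"
      unfolding span_pair by blast
  next
    fix x assume "x \<in> vec.span {a1, b1}"
    then obtain c d where x: "x = c *s a1 + d *s b1"
      unfolding span_pair by blast
    have "smooth_on U (\<lambda>w. c *s a w + d *s b w)"
      by (intro smooth_on_add smooth_on_scale smooth_on_const op sm)
    then have "smooth_section U \<psi> (\<lambda>w. c *s a w + d *s b w)"
      using \<psi> unfolding smooth_section_def span_pair by blast
    moreover have "A_wd e \<psi> (\<lambda>w. c *s a w + d *s b w) z = x"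
      unfolding x using op by (intro A[of U "\<lambda>w. c" "\<lambda>w. d"] smooth_on_const) auto
    ultimately show "x \<in> image_at M (A_wd e) \<psi> z"
      unfolding image_at_def using op by blast
  qed
qed

section \<open>Extension of identities across isolated points\<close>

lemma smooth_on_eventually_zero:
  fixes h :: "complex \<Rightarrow> 'b::real_normed_vector"
  assumes "open U" "z \<in> U" "smooth_on U h" "eventually (\<lambda>w. h w = 0) (at z)"
  shows "h z = 0"
proof -
  have "isCont h z"
    using smooth_on_continuous_on[OF assms(3)] assms(1,2) by (simp add: continuous_on_eq_continuous_at)
  then have "(h \<longlongrightarrow> h z) (at z)"
    by (simp add: isCont_def)
  moreover have "(h \<longlongrightarrow> 0) (at z)"
    using assms(4) by (rule tendsto_eventually)
  ultimately show ?thesis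
    by (rule tendsto_unique[OF at_neq_bot])
qed

text \<open>Carries membership in a moving plane over to the exceptional point; independence at
  \<open>z\<close> allows division by \<open>P z\<close> and \<open>Q z\<close> there.\<close>

lemma span_limit:
  fixes p q v :: "complex \<Rightarrow> 'm::finite cvec"
  assumes op: "open U" "z \<in> U" and sm: "smooth_on U p" "smooth_on U q" "smooth_on U v"
    and ind: "p z \<noteq> q z" "vec.independent {p z, q z}"
    and ev: "eventually (\<lambda>w. v w \<in> vec.span {p w, q w}) (at z)"
  shows "v z \<in> vec.span {p z, q z}"
proof -
  \<comment> \<open>\<open>r\<close> is the Gram-Schmidt residual of \<open>v\<close> with the denominators cleared, so that it is smooth even
    where \<open>p\<close> and \<open>q\<close> are dependent.\<close>
  define P where "P = (\<lambda>w. herm (p w) (p w))"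
  define q' where "q' = (\<lambda>w. P w *s q w - herm (q w) (p w) *s p w)"
  define Q where "Q = (\<lambda>w. herm (q' w) (q' w))"
  define r where "r = (\<lambda>w. (P w * Q w) *s v w - (herm (v w) (p w) * Q w) *s p w
    - (P w * herm (v w) (q' w)) *s q' w)"
  have "smooth_on U P" "smooth_on U q'" "smooth_on U Q"
    unfolding P_def q'_def Q_def
    by (intro smooth_on_diff smooth_on_scale smooth_on_herm op sm)+
  then have "smooth_on U r"
    unfolding r_def by (intro smooth_on_diff smooth_on_scale smooth_on_mult smooth_on_herm op sm)
  moreover have "r w = 0" if w: "v w \<in> vec.span {p w, q w}" for w
  proof -
    obtain c d where v: "v w = c *s p w + d *s q w"
      using w unfolding span_pair by blast
    have pq': "herm (p w) (q' w) = 0"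
      unfolding herm_eq_0_sym[of "p w"]
      by (simp add: q'_def P_def herm_simps mult.commute)
    have Pq: "P w *s q w = q' w + herm (q w) (p w) *s p w"
      by (simp add: q'_def)
    \<comment> \<open>Pairing with \<open>q'\<close> removes the component along \<open>p\<close>;
      this recovers the coefficient \<open>d\<close> of \<open>v\<close> without any
      division.\<close>
    have "P w * herm (q w) (q' w) = Q w"
      using pq' unfolding herm_scale_left[symmetric] Pq Q_def by (simp add: herm_simps)
    then have "P w * herm (v w) (q' w) = d * Q w"
      by (simp add: v herm_simps pq' algebra_simps)
    then have "r w = (P w * Q w * c) *s p w + (Q w * d) *s (P w *s q w)
        - ((c * P w + d * herm (q w) (p w)) * Q w) *s p w - (d * Q w) *s q' w"
      unfolding r_def by (simp add: v herm_simps P_def vec_eq_iff algebra_simps)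
    then show ?thesis
      unfolding Pq by (simp add: vec_eq_iff algebra_simps)
  qed
  then have "eventually (\<lambda>w. r w = 0) (at z)"
    using ev by (rule eventually_mono[rotated])
  ultimately have r0: "r z = 0"
    by (rule smooth_on_eventually_zero[OF op])
  have "p z \<noteq> 0"
    using ind vec.dependent_zero[of "{p z, q z}"] by auto
  then have P0: "P z \<noteq> 0"
    by (simp add: P_def)
  have "q z \<notin> cp (p z)"
    using ind vec.independent_insert[of "q z" "{p z}"] by (simp add: cp_def insert_commute)
  moreover have "q z = (herm (q z) (p z) / P z) *s p z" if "q' z = 0"
    using that P0 by (simp add: q'_def vec_eq_iff field_simps)
  ultimately have "q' z \<noteq> 0"
    by (auto simp: cp_eq)
  then have Q0: "Q z \<noteq> 0"
    by (simp add: Q_def)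
  have "(P z * Q z) *s v z \<in> vec.span {p z, q z}"
  proof -
    have "q' z \<in> vec.span {p z, q z}"
      unfolding q'_def by (intro vec.span_diff vec.span_scale vec.span_base) auto
    then have "(herm (v z) (p z) * Q z) *s p z + (P z * herm (v z) (q' z)) *s q' z
        \<in> vec.span {p z, q z}"
      by (intro vec.span_add vec.span_scale) (auto intro: vec.span_base)
    also have "(herm (v z) (p z) * Q z) *s p z + (P z * herm (v z) (q' z)) *s q' z
        = (P z * Q z) *s v z"
      using r0 by (simp add: r_def vec_eq_iff algebra_simps)
    finally show ?thesis .
  qed
  from vec.span_scale[OF this, of "inverse (P z * Q z)"] show ?thesis
    using P0 Q0 by (simp add: vector_smult_assoc del: inverse_mult_distrib)
qed

text \<open>Nonzero orthogonal vectors are independent, and two independent vectors in a span of two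
  vectors fill it by dimension.\<close>

lemma direct_sum_orthogonal_lines:
  assumes x: "x \<noteq> 0" and y: "y \<noteq> 0" and orth: "herm x y = 0"
    and mem: "x \<in> vec.span {p, q}" "y \<in> vec.span {p, q}"
  shows "direct_sum (vec.span {p, q}) (cp x) (cp y)"
proof -
  have disj: "cp x \<inter> cp y = {0}"
  proof -
    have "c *s x = 0" if "c *s x = d *s y" for c d
      using arg_cong[OF that, of "\<lambda>v. herm v x"] x herm_eq_0_sym[of x y] orth
      by (simp add: herm_scale_left)
    then show ?thesis
      by (auto simp: cp_eq)
  qed
  then have "x \<notin> cp y"
    using x vec.span_base[of x "{x}"] by (auto simp: cp_def)
  then have ind: "vec.independent {x, y}" "x \<noteq> y"
    using y vec.span_base[of y "{y}"] by (auto simp: cp_def vec.independent_insert)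
  have "vec.dim (vec.span {p, q}) \<le> card {p, q}"
    unfolding vec.dim_span by (rule vec.dim_le_card') simp
  also have "\<dots> \<le> card {x, y}"
    using ind(2) by (simp add: card_insert_if)
  finally have "vec.span {p, q} \<subseteq> vec.span {x, y}"
    using mem by (intro vec.card_ge_dim_independent[OF _ ind(1)]) simp_all
  moreover have "vec.span {x, y} \<subseteq> vec.span {p, q}"
    using mem by (intro vec.span_minimal) auto
  ultimately have "vec.span {p, q} = vec.span {x, y}"
    by (rule subset_antisym)
  also have "\<dots> = {a + b |a b. a \<in> cp x \<and> b \<in> cp y}"
    unfolding span_pair cp_eq by blast
  finally have "vec.span {p, q} = {a + b |a b. a \<in> cp x \<and> b \<in> cp y}" .
  with disj show ?thesis
    by (simp add: direct_sum_def)
qed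

section \<open>The harmonic sequences expressed by the sections, off isolated points\<close>

context horizontal_harmonic_lift
begin

lemma smooth_fs_on: "U \<subseteq> N e k \<Longrightarrow> smooth_on U (fs e s k)"
  by (rule smooth_on_subset[OF smooth_fs])

text \<open>Induction with \<open>image_at_line\<close>; nonvanishing of the sections is carried
  along because the next step needs them as a frame.\<close>

lemma line_bundles:
  assumes bun: "\<And>k. subbundle M 1 (G k)" and G0: "\<And>z. z \<in> M \<Longrightarrow> G 0 z = cp (s z)"
    and step: "\<And>k. eventually (\<lambda>z. G (Suc k) z = image_at M (A_wd e) (G k) z) (cosparse M)"
  shows "eventually (\<lambda>z. fs e s k z \<noteq> 0 \<and> G k z = cp (fs e s k z)) (cosparse M)"
proof (induction k)
  case 0
  have "eventually (\<lambda>z. z \<in> M) (cosparse M)"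
    using open_M by (simp add: eventually_cosparse_open_eq eventually_at_in_open')
  then show ?case
    by eventually_elim (simp add: G0 s_nonzero)
next
  case (Suc k)
  show ?case
    using eventually_cosparse_nhd[OF open_M Suc.IH] step[of k]
  proof eventually_elim
    case (elim z)
    then obtain U where U: "open U" "z \<in> U" "U \<subseteq> M"
      and G: "\<And>w. w \<in> U \<Longrightarrow> fs e s k w \<noteq> 0 \<and> G k w = cp (fs e s k w)"
      by blast
    have sub: "U \<subseteq> N e k"
      using G U(3) by (auto simp: N_def)
    have "image_at M (A_wd e) (G k) z = cp (fs e s (Suc k) z)"
      using G[OF U(2)]
      by (intro image_at_line[OF U smooth_fs_on[OF sub] G wd_fs_eq fs_orthogonal]) simp_all
    then have "G (Suc k) z = cp (fs e s (Suc k) z)"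
      using elim(2) by simp
    \<comment> \<open>\<open>G (Suc k)\<close> has rank one, which excludes a zero of the new
      section at \<open>z\<close>.\<close>
    moreover obtain E where "E \<noteq> 0" "G (Suc k) z = cp E"
      using subbundle_line_frame[OF bun, of z "Suc k"] U by (metis subsetD)
    then have "fs e s (Suc k) z \<noteq> 0"
      using calculation vec.span_base[of E "{E}"] by (auto simp: cp_def)
    ultimately show ?case
      by blast
  qed
qed

text \<open>Induction with \<open>image_at_plane\<close> and the frame \<open>f_k\<close>,
  \<open>j f_{-k}\<close>. The first relation of \<open>symplectic\<close> makes the frame
  orthogonal, and the second, for both signs, places the new sections orthogonal to the old
  plane.\<close>

lemma plane_bundles:
  assumes G0: "\<And>z. z \<in> M \<Longrightarrow> G 0 z = hp (s z)"
    and step: "\<And>k. eventually (\<lambda>z. G (Suc k) z = image_at M (A_wd 1) (G k) z) (cosparse M)"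
    and nz: "\<And>e k. e * e = 1 \<Longrightarrow> eventually (\<lambda>z. fs e s k z \<noteq> 0) (cosparse M)"
  shows "eventually (\<lambda>z. G k z = vec.span {fs 1 s k z, jmul (fs (- 1) s k z)}) (cosparse M)"
proof (induction k)
  case 0
  have "eventually (\<lambda>z. z \<in> M) (cosparse M)"
    using open_M by (simp add: eventually_cosparse_open_eq eventually_at_in_open')
  then show ?case
    by eventually_elim (simp add: G0 hp_def)
next
  case (Suc k)
  have "eventually (\<lambda>z. fs 1 s k z \<noteq> 0 \<and> fs (- 1) s k z \<noteq> 0 \<and>
      G k z = vec.span {fs 1 s k z, jmul (fs (- 1) s k z)}) (cosparse M)"
    using Suc.IH nz[of 1 k] nz[of "- 1" k] by (simp add: eventually_conj_iff)
  from eventually_cosparse_nhd[OF open_M this] step[of k] show ?case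
  proof eventually_elim
    case (elim z)
    then obtain U where U: "open U" "z \<in> U" "U \<subseteq> M"
      and G: "\<And>w. w \<in> U \<Longrightarrow> fs 1 s k w \<noteq> 0 \<and> fs (- 1) s k w \<noteq> 0 \<and>
        G k w = vec.span {fs 1 s k w, jmul (fs (- 1) s k w)}"
      by blast
    have sub: "U \<subseteq> N 1 k" "U \<subseteq> N (- 1) k"
      using G U(3) by (auto simp: N_def)
    have z: "z \<in> M"
      using U by blast
    have G': "fs 1 s k w \<noteq> 0 \<and> jmul (fs (- 1) s k w) \<noteq> 0 \<and>
        herm (fs 1 s k w) (jmul (fs (- 1) s k w)) = 0 \<and>
        G k w = vec.span {fs 1 s k w, jmul (fs (- 1) s k w)}" if "w \<in> U" for w
      using G[OF that] symplectic(1)[of 1 w k] U(3) that by auto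
    have smj: "smooth_on U (\<lambda>w. jmul (fs (- 1) s k w))"
      by (rule smooth_on_linear[OF U(1) bounded_linear_jmul smooth_fs_on[OF sub(2)]])
    have "z \<in> N (- 1) k"
      using sub U by blast
    \<comment> \<open>By \<open>wd_jmul\<close>, the upward derivative of \<open>j f_{-k}\<close> is
      j applied to one step of the downward recursion.\<close>
    then have wdj: "wd 1 (\<lambda>w. jmul (fs (- 1) s k w)) z
        = jmul (fs (- 1) s (Suc k) z) + cnj (fs_coeff (- 1) s k z) *s jmul (fs (- 1) s k z)"
      unfolding wd_jmul[OF differentiable_fs[OF \<open>z \<in> N (- 1) k\<close>]]
      using wd_fs_eq[of "- 1" s k z] by (simp add: N_def jmul_add jmul_scale del: fs.simps)
    have "herm (jmul (fs (- 1) s (Suc k) z)) (fs 1 s k z) = 0"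
      using symplectic(2)[of "- 1" z k] z
      by (simp add: herm_jmul_left[of _ "fs 1 s k z"] herm_jmul_right[of "fs 1 s k z"] del: fs.simps)
    moreover have "herm (jmul (fs (- 1) s (Suc k) z)) (jmul (fs (- 1) s k z)) = 0"
      unfolding herm_jmul_jmul using fs_orthogonal herm_eq_0_sym by blast
    ultimately have "image_at M (A_wd 1) (G k) z
        = vec.span {fs 1 s (Suc k) z, jmul (fs (- 1) s (Suc k) z)}"
      using G[OF U(2)] symplectic(2)[of 1 z k] z
      by (intro image_at_plane[OF U smooth_fs_on[OF sub(1)] smj G' wd_fs_eq wdj fs_orthogonal])
        simp_all
    then show ?case
      using elim(2) by (simp del: fs.simps)
  qed
qed

end

section \<open>Return to integer indices and the final assembly\<close>

lemma f_seq_int: "f_seq s (int k) = fs 1 s k"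
  by (simp add: f_seq_def f_up_eq_fs)

lemma f_seq_minus_int: "f_seq s (- int k) = fs (- 1) s k"
  by (cases "k = 0") (simp_all add: f_seq_def f_up_eq_fs f_down_eq_fs)

lemma (in horizontal_harmonic_lift) f_seq_symplectic:
  assumes z: "z \<in> M" and q: "q \<in> {int k - 2, int k - 1, int k}"
  shows "herm (f_seq s (int k) z) (jmul (f_seq s (- q) z)) = 0"
    and "herm (f_seq s q z) (jmul (f_seq s (- int k) z)) = 0"
proof -
  note [simp del] = fs.simps(2)
  have sym: "herm v (jmul w) = 0 \<longleftrightarrow> herm w (jmul v) = 0" for v w :: "'m cvec"
    using herm_jmul_right[of v w] by auto
  have sp: "herm (fs 1 s l z) (jmul (fs (- 1) s l z)) = 0"
    "herm (fs 1 s (Suc l) z) (jmul (fs (- 1) s l z)) = 0"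
    "herm (fs 1 s (Suc (Suc l)) z) (jmul (fs (- 1) s l z)) = 0"
    "herm (fs 1 s l z) (jmul (fs (- 1) s (Suc l) z)) = 0"
    "herm (fs 1 s l z) (jmul (fs (- 1) s (Suc (Suc l)) z)) = 0" for l
    using symplectic[of 1 z l] symplectic[of "- 1" z l] z sym by auto
  have s0: "herm (s z) (jmul (fs e s (Suc 0) z)) = 0" "herm (fs e s (Suc 0) z) (jmul (s z)) = 0"
    "herm (s z) (jmul (fs e s (Suc (Suc 0)) z)) = 0"
    "herm (fs e s (Suc (Suc 0)) z) (jmul (s z)) = 0" for e
    using symplectic_0[OF z, of e] sym by auto
  have neg: "f_seq s (- 1) = fs (- 1) s (Suc 0)" "f_seq s (- 2) = fs (- 1) s (Suc (Suc 0))"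
    and pos: "f_seq s 0 = s" "f_seq s 1 = fs 1 s (Suc 0)" "f_seq s 2 = fs 1 s (Suc (Suc 0))"
    using f_seq_minus_int[of s 1] f_seq_minus_int[of s 2] f_seq_int[of s 0] f_seq_int[of s 1]
      f_seq_int[of s 2] by (simp_all add: numeral_2_eq_2)
  \<comment> \<open>For \<open>k < 2\<close> the index \<open>q\<close> can be negative. Then both
    sections come from the same half of the sequence, and \<open>symplectic_0\<close> or
    skew-symmetry replaces \<open>symplectic\<close>.\<close>
  consider l where "k = Suc (Suc l)" | "k = Suc 0" | "k = 0"
    by (metis not0_implies_Suc)
  then have "herm (f_seq s (int k) z) (jmul (f_seq s (- q) z)) = 0 \<and>
    herm (f_seq s q z) (jmul (f_seq s (- int k) z)) = 0"
  proof cases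
    case (1 l)
    then have "q = int l \<or> q = int (Suc l) \<or> q = int k"
      using q by auto
    then show ?thesis
      using sp 1 unfolding f_seq_int by (elim disjE) (simp_all only: f_seq_int f_seq_minus_int)
  next
    case 2
    then have "q = - 1 \<or> q = 0 \<or> q = 1"
      using q by auto
    then show ?thesis
      using sp[of 0] sp[of "Suc 0"] s0 2 neg pos by auto
  next
    case 3
    then have "q = - 2 \<or> q = - 1 \<or> q = 0"
      using q by auto
    then show ?thesis
      using s0 3 neg pos by auto
  qed
  then show "herm (f_seq s (int k) z) (jmul (f_seq s (- q) z)) = 0"
    and "herm (f_seq s q z) (jmul (f_seq s (- int k) z)) = 0"
    by blast+
qed

theorem proposition3p5:
  fixes M :: "complex set" and g :: "complex \<Rightarrow> real"
    and \<phi> :: "complex \<Rightarrow> 'm::finite cvec set"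
    and \<Phi> F :: "int \<Rightarrow> complex \<Rightarrow> 'm cvec set"
    and s :: "complex \<Rightarrow> 'm cvec"
  assumes "open M" and "M \<noteq> {}" and "connected M" and "simply_connected M"
    and "smooth_on M g" and "\<forall>z\<in>M. g z > 0"
    and "hp_smooth M \<phi>" and "hp_isometric M g \<phi>" and "hp_totally_real M \<phi>"
    and "hp_harmonic M \<phi>" and "linearly_full M \<phi>"
    and "harmonic_sequence M 2 \<Phi>" and "\<forall>z\<in>M. \<Phi> 0 z = \<phi> z"
    and "\<forall>k. \<forall>z\<in>M. \<Phi> (- k) z = jmul ` \<Phi> k z"
    and "totally_real_horizontal_minimal_lift M g \<phi> s"
    and "harmonic_sequence M 1 F" and "\<forall>z\<in>M. F 0 z = cp (s z)"
  shows "\<forall>k::nat. \<forall>z\<in>M.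
    (\<forall>q \<in> {int k - 2, int k - 1, int k}.
       herm (f_seq s (int k) z) (jmul (f_seq s (- q) z)) = 0 \<and>
       herm (jmul (f_seq s (- int k) z)) (f_seq s q z) = 0) \<and>
    direct_sum (\<Phi> (int k) z) (F (int k) z) (jmul ` F (- int k) z)"
proof -
  interpret horizontal_harmonic_lift M s
    by (rule horizontal_harmonic_lift_of_minimal[OF assms(1,15)])
  have bunF: "subbundle M 1 (F k)" and bun\<Phi>: "subbundle M 2 (\<Phi> k)" for k
    using assms(12,16) by (simp_all add: harmonic_sequence_def harmonic_subbundle_def)
  have up: "eventually (\<lambda>z. fs 1 s k z \<noteq> 0 \<and> F (int k) z = cp (fs 1 s k z)) (cosparse M)" for k
  proof (rule line_bundles[of "\<lambda>k. F (int k)"])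
    show "eventually (\<lambda>z. F (int (Suc k)) z = image_at M (A_wd 1) (F (int k)) z) (cosparse M)" for k
    proof -
      have "eventually (\<lambda>z. F (int k + 1) z = image_at M (A_wd 1) (F (int k)) z) (cosparse M)"
        using assms(16) unfolding harmonic_sequence_def A'_eq by simp
      then show ?thesis
        by (simp add: add.commute)
    qed
  qed (use bunF assms(17) in auto)
  have down: "eventually (\<lambda>z. fs (- 1) s k z \<noteq> 0 \<and> F (- int k) z = cp (fs (- 1) s k z))
    (cosparse M)" for k
  proof (rule line_bundles[of "\<lambda>k. F (- int k)"])
    show "eventually (\<lambda>z. F (- int (Suc k)) z = image_at M (A_wd (- 1)) (F (- int k)) z) (cosparse M)"
      for k
    proof -
      have "eventually (\<lambda>z. F (- int k - 1) z = image_at M (A_wd (- 1)) (F (- int k)) z) (cosparse M)"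
        using assms(16) unfolding harmonic_sequence_def A''_eq by simp
      moreover have "- int (Suc k) = - int k - 1"
        by simp
      ultimately show ?thesis
        by (simp only:)
    qed
  qed (use bunF assms(17) in auto)
  have nz: "eventually (\<lambda>z. fs e s k z \<noteq> 0) (cosparse M)" if "e * e = 1" for e k
    using up[of k] down[of k] square_eq_1_iff[THEN iffD1, OF that] by (auto elim: eventually_mono)
  have plane: "eventually (\<lambda>z. \<Phi> (int k) z = vec.span {fs 1 s k z, jmul (fs (- 1) s k z)}) (cosparse M)"
    for k
  proof (rule plane_bundles[of "\<lambda>k. \<Phi> (int k)"])
    show "\<Phi> (int 0) z = hp (s z)" if "z \<in> M" for z
      using assms(13,15) that by (simp add: totally_real_horizontal_minimal_lift_def hp_lift_def)
    show "eventually (\<lambda>z. \<Phi> (int (Suc k)) z = image_at M (A_wd 1) (\<Phi> (int k)) z) (cosparse M)" for k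
    proof -
      have "eventually (\<lambda>z. \<Phi> (int k + 1) z = image_at M (A_wd 1) (\<Phi> (int k)) z) (cosparse M)"
        using assms(12) unfolding harmonic_sequence_def A'_eq by simp
      then show ?thesis
        by (simp add: add.commute)
    qed
  qed (rule nz)
  \<comment> \<open>At an exceptional point the sections may vanish, so the argument passes to
    smooth frames of the three bundles, which do not degenerate there.\<close>
  have "direct_sum (\<Phi> (int k) z) (F (int k) z) (jmul ` F (- int k) z)" if z: "z \<in> M" for k z
  proof -
    obtain U1 E where U1: "open U1" "z \<in> U1" "U1 \<subseteq> M" "smooth_on U1 E"
      and E: "\<And>w. w \<in> U1 \<Longrightarrow> E w \<noteq> 0 \<and> F (int k) w = cp (E w)"
      using subbundle_line_frame[OF bunF z] by blast
    obtain U2 E' where U2: "open U2" "z \<in> U2" "U2 \<subseteq> M" "smooth_on U2 E'"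
      and E': "\<And>w. w \<in> U2 \<Longrightarrow> E' w \<noteq> 0 \<and> F (- int k) w = cp (E' w)"
      using subbundle_line_frame[OF bunF z] by blast
    obtain U3 p q where U3: "open U3" "z \<in> U3" "U3 \<subseteq> M" "smooth_on U3 p" "smooth_on U3 q"
      and pq: "\<And>w. w \<in> U3 \<Longrightarrow> p w \<noteq> q w \<and> vec.independent {p w, q w} \<and>
        \<Phi> (int k) w = vec.span {p w, q w}"
      using subbundle_plane_frame[OF bun\<Phi> z] by blast
    define U where "U = U1 \<inter> U2 \<inter> U3"
    have U: "open U" "z \<in> U"
      unfolding U_def using U1 U2 U3 by auto
    have sub: "U \<subseteq> U1" "U \<subseteq> U2" "U \<subseteq> U3"
      unfolding U_def by auto
    have sm: "smooth_on U E" "smooth_on U (\<lambda>w. jmul (E' w))" "smooth_on U p" "smooth_on U q"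
      using U1(4) U2(4) U3(4,5) sub
      by (auto intro: smooth_on_subset smooth_on_linear[OF U(1) bounded_linear_jmul])
    have inU: "eventually (\<lambda>w. w \<in> U) (at z)"
      using U by (simp add: eventually_at_in_open')
    \<comment> \<open>Near \<open>z\<close>, but off \<open>z\<close>, the frames \<open>E\<close>
      and \<open>E'\<close> are multiples of \<open>f_k\<close> and \<open>f_{-k}\<close> and
      inherit their relations.\<close>
    have ev: "eventually (\<lambda>w. herm (E w) (jmul (E' w)) = 0 \<and> E w \<in> vec.span {p w, q w} \<and>
        jmul (E' w) \<in> vec.span {p w, q w}) (at z)"
      using eventually_cosparse_imp_eventually_at[OF up[of k] z, of UNIV]
        eventually_cosparse_imp_eventually_at[OF down[of k] z, of UNIV]
        eventually_cosparse_imp_eventually_at[OF plane[of k] z, of UNIV] inU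
    proof eventually_elim
      case (elim w)
      then have w: "w \<in> U1" "w \<in> U2" "w \<in> U3" "w \<in> M"
        using sub U1(3) by auto
      have "E w \<in> cp (fs 1 s k w)" "E' w \<in> cp (fs (- 1) s k w)"
        using elim E[OF w(1)] E'[OF w(2)] vec.span_base[of "E w" "{E w}"]
          vec.span_base[of "E' w" "{E' w}"] by (auto simp: cp_def)
      then obtain c d where cd: "E w = c *s fs 1 s k w" "E' w = d *s fs (- 1) s k w"
        unfolding cp_eq by blast
      have "vec.span {p w, q w} = vec.span {fs 1 s k w, jmul (fs (- 1) s k w)}"
        using elim pq[OF w(3)] by simp
      then show ?case
        using symplectic(1)[of 1 w k] w(4)
        by (auto simp: cd jmul_scale herm_simps intro: vec.span_scale vec.span_base)
    qed
    \<comment> \<open>The orthogonality has to pass to the limit too: it makes the two lines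
      independent at \<open>z\<close> itself.\<close>
    have "herm (E z) (jmul (E' z)) = 0"
      using ev by (intro smooth_on_eventually_zero[OF U smooth_on_herm[OF U(1) sm(1,2)]])
        (auto elim: eventually_mono)
    moreover have "E z \<in> vec.span {p z, q z}" "jmul (E' z) \<in> vec.span {p z, q z}"
      using ev pq[of z] U3(2)
      by (auto intro!: span_limit[OF U sm(3,4,1)] span_limit[OF U sm(3,4,2)] elim: eventually_mono)
    ultimately have "direct_sum (vec.span {p z, q z}) (cp (E z)) (cp (jmul (E' z)))"
      using E[OF U1(2)] E'[OF U2(2)] by (intro direct_sum_orthogonal_lines) auto
    then show ?thesis
      using E[OF U1(2)] E'[OF U2(2)] pq[OF U3(2)] by (simp add: jmul_cp)
  qed
  moreover have "herm (f_seq s (int k) z) (jmul (f_seq s (- q) z)) = 0 \<and>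
      herm (jmul (f_seq s (- int k) z)) (f_seq s q z) = 0"
    if "z \<in> M" "q \<in> {int k - 2, int k - 1, int k}" for k z q
    using f_seq_symplectic[OF that] by (simp add: herm_jmul_left[of _ "f_seq s q z"])
  ultimately show ?thesis
    by blast
qed

end
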